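(* Let $\Gamma=(V,E)$ be a finite connected simple undirected graph, let $B\subsetneq V$ be a set of $m\geq 2$ vertices, no two of which are adjacent, and let $u:B\to\mathbb{R}$ be injective. Let $\mathcal{A}_{\Gamma,u}$ be the associated Dirichlet arrangement, let $\mathcal{A}_\Gamma$ be the graphic arrangement of $\Gamma$ over $\mathbb{R}$, and let $\widehat{\Gamma}$ be the graph obtained from $\Gamma$ by adding an edge between each pair of elements of $B$. The following hold: (i) Identifying the intersection poset $L(\mathcal{A}_\Gamma)$ with the lattice of connected partitions of $\Gamma$ ordered by refinement, the intersection poset $L(\mathcal{A}_{\Gamma,u})$ is isomorphic, as a poset, to the order ideal of $L(\mathcal{A}_\Gamma)$ consisting of all boundary-separating connected partitions of $\Gamma$. (ii) The characteristic polynomial of $\mathcal{A}_{\Gamma,u}$ is the quotient of the chromatic polynomial of $\widehat{\Gamma}$ by a falling factorial, namely $$\chi_{\mathcal{A}_{\Gamma,u}}(t)=\frac{\chi_{\widehat{\Gamma}}(t)}{t(t-1)\cdots(t-m+1)}.$$ (iii) The bounded chambers of $\mathcal{A}_{\Gamma,u}$ are in bijection with the possible orientations of current flow through $\Gamma$ respecting the voltages $u$ in which the current flowing through each edge is nonzero.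
   Context: Graphs are finite, connected, undirected, with no loops or multiple edges. The elements of $B$ are called boundary nodes; write $V^\circ=V\setminus B$ and $n=|V^\circ|$. The graphic arrangement $\mathcal{A}_\Gamma$ is the set of hyperplanes $\{x_i=x_j\}$ in $\mathbb{R}^V$, one for each edge $ij\in E$. Let $X=\{x\in\mathbb{R}^V: x_j=u(j)\text{ for all }j\in B\}\cong\mathbb{R}^n$ (with coordinates indexed by $V^\circ$). The Dirichlet arrangement $\mathcal{A}_{\Gamma,u}$ is the arrangement in $X$ of the hyperplanes $H\cap X$ for $H\in\mathcal{A}_\Gamma$. For an arrangement $\mathcal{A}$ of affine hyperplanes, the intersection poset $L(\mathcal{A})$ is the set of nonempty intersections of elements of $\mathcal{A}$ (including the whole space as the empty intersection), ordered by reverse inclusion and graded by codimension; $\chi_{\mathcal{A}}$ is the characteristic polynomial of $L(\mathcal{A})$, i.e. $\chi_{\mathcal{A}}(t)=\sum_{Y\in L(\mathcal{A})}\mu(Y)\,t^{\dim Y}$ with $\mu$ the Möbius function from the bottom element. Chambers are the connected components of the complement of the union of the hyperplanes. A connected partition of $\Gamma$ is a partition of $V$ whose blocks induce connected subgraphs of $\Gamma$; connected partitions are ordered so that $\pi\leq\pi'$ means $\pi$ is a refinement of $\pi'$. A connected partition $\pi$ is boundary-separating if $|P\cap B|\leq 1$ for every block $P\in\pi$. The lattice of connected partitions is isomorphic to $L(\mathcal{A}_\Gamma)$ by sending $\pi$ to $\{x\in\mathbb{R}^V: x_i=x_j\text{ whenever }i,j\text{ lie in the same block of }\pi\}$. An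 order ideal is a down-closed subset. Current flow: for conductances $c\in(0,\infty)^E$ there is a unique $h\in\mathbb{R}^V$ with $h_j=u(j)$ for all $j\in B$ and $\sum_{j\sim i}c_{ij}(h_i-h_j)=0$ for all $i\in V^\circ$. The current through edge $ij$ is $c_{ij}(h_i-h_j)$, flowing from the endpoint with larger value of $h$ to the endpoint with smaller value. The possible orientations of current flow through $\Gamma$ respecting the voltages $u$ with nonzero current on every edge are the orientations of $\Gamma$ for which there is some $c\in(0,\infty)^E$ whose $h$ satisfies $h_i\neq h_j$ for all $ij\in E$, and each edge $ij$ is oriented from $i$ to $j$ exactly when $h_i>h_j$. *)

theory Defs
  imports "HOL-Analysis.Analysis" "HOL-Library.Disjoint_Sets"
    "HOL-Computational_Algebra.Polynomial"
begin

text \<open>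
  The vertex set of a graph is the whole of a finite type \<open>'v\<close>, so that \<open>\<real>\<^sup>V\<close> is
  \<open>real ^ 'v\<close>; an edge is a two-element set of vertices.
\<close>

definition simple_graph :: "'v set set \<Rightarrow> bool" where
  "simple_graph E \<longleftrightarrow> (\<forall>e\<in>E. card e = 2)"

definition induces_connected :: "'v set set \<Rightarrow> 'v set \<Rightarrow> bool" where
  "induces_connected E S \<longleftrightarrow>
     S \<noteq> {} \<and> (\<forall>i\<in>S. \<forall>j\<in>S. (i, j) \<in> {(a, b). a \<in> S \<and> b \<in> S \<and> {a, b} \<in> E}\<^sup>*)"

definition connected_graph :: "'v set set \<Rightarrow> bool" where
  "connected_graph E \<longleftrightarrow> induces_connected E UNIV"

definition add_clique :: "'v set set \<Rightarrow> 'v set \<Rightarrow> 'v set set" where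
  "add_clique E B = E \<union> {{i, j} | i j. i \<in> B \<and> j \<in> B \<and> i \<noteq> j}"


subsection \<open>Arrangements\<close>

definition graphic_arrangement :: "'v::finite set set \<Rightarrow> (real ^ 'v) set set" where
  "graphic_arrangement E = {{x. x $ i = x $ j} | i j. {i, j} \<in> E}"

definition boundary_space :: "'v::finite set \<Rightarrow> ('v \<Rightarrow> real) \<Rightarrow> (real ^ 'v) set" where
  "boundary_space B u = {x. \<forall>j\<in>B. x $ j = u j}"

text \<open>
  The ambient space \<open>boundary_space B u\<close> is kept as an affine subspace of \<open>\<real>\<^sup>V\<close>; its
  hyperplanes are affine subspaces of \<open>\<real>\<^sup>V\<close> as well.
\<close>

definition dirichlet_arrangement ::
    "'v::finite set set \<Rightarrow> 'v set \<Rightarrow> ('v \<Rightarrow> real) \<Rightarrow> (real ^ 'v) set set" where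
  "dirichlet_arrangement E B u = {H \<inter> boundary_space B u | H. H \<in> graphic_arrangement E}"

text \<open>
  In the next definitions \<open>X\<close> is the ambient space of the arrangement \<open>\<A>\<close>.  The empty
  intersection is \<open>X\<close>, since \<open>\<Inter>{} = UNIV\<close>.
\<close>

definition intersection_poset :: "'a set \<Rightarrow> 'a set set \<Rightarrow> 'a set set" where
  "intersection_poset X \<A> = {Y. Y \<noteq> {} \<and> (\<exists>\<S>\<subseteq>\<A>. Y = X \<inter> \<Inter>\<S>)}"

text \<open>
  The Moebius function of a finite family \<open>L\<close> of sets ordered by \<^emph>\<open>reverse\<close> inclusion:
  \<open>moebius L X Y\<close> is the value on the interval from \<open>X\<close> up to \<open>Y\<close>, that is \<open>Y \<subseteq> X\<close>.
\<close>

function moebius :: "'a set set \<Rightarrow> 'a set \<Rightarrow> 'a set \<Rightarrow> int" where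
  "moebius L X Y =
     (if finite L \<and> X \<in> L \<and> Y \<in> L \<and> Y \<subseteq> X
      then if Y = X then 1 else - (\<Sum>Z\<in>{Z\<in>L. Y \<subset> Z \<and> Z \<subseteq> X}. moebius L X Z)
      else 0)"
  by pat_completeness auto
termination
proof (relation "Wellfounded.measure (\<lambda>(L, X, Y). card {Z\<in>L. Y \<subset> Z})", goal_cases)
  case 1
  show ?case by simp
next
  case (2 L X Y Z)
  then have "{W\<in>L. Z \<subset> W} \<subset> {W\<in>L. Y \<subset> W}" by auto
  with 2 show ?case by (auto intro!: psubset_card_mono)
qed

declare moebius.simps [simp del]

definition characteristic_poly :: "'a::euclidean_space set \<Rightarrow> 'a set set \<Rightarrow> int poly" where
  "characteristic_poly X \<A> =
     (\<Sum>Y\<in>intersection_poset X \<A>.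
        monom (moebius (intersection_poset X \<A>) X Y) (nat (aff_dim Y)))"

definition chambers :: "'a::euclidean_space set \<Rightarrow> 'a set set \<Rightarrow> 'a set set" where
  "chambers X \<A> = components (X - \<Union>\<A>)"


subsection \<open>Connected partitions and posets\<close>

definition connected_partitions :: "'v set set \<Rightarrow> 'v set set set" where
  "connected_partitions E =
     {\<pi>. partition_on UNIV \<pi> \<and> (\<forall>P\<in>\<pi>. induces_connected E P)}"

definition boundary_separating :: "'v set \<Rightarrow> 'v set set \<Rightarrow> bool" where
  "boundary_separating B \<pi> \<longleftrightarrow> (\<forall>P\<in>\<pi>. card (P \<inter> B) \<le> 1)"

definition partition_flat :: "'v::finite set set \<Rightarrow> (real ^ 'v) set" where
  "partition_flat \<pi> = {x. \<forall>P\<in>\<pi>. \<forall>i\<in>P. \<forall>j\<in>P. x $ i = x $ j}"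

definition poset_iso_map ::
    "('a \<Rightarrow> 'b) \<Rightarrow> 'a set \<Rightarrow> ('a \<Rightarrow> 'a \<Rightarrow> bool) \<Rightarrow> 'b set \<Rightarrow> ('b \<Rightarrow> 'b \<Rightarrow> bool) \<Rightarrow> bool" where
  "poset_iso_map f P le Q le' \<longleftrightarrow>
     bij_betw f P Q \<and> (\<forall>x\<in>P. \<forall>y\<in>P. le x y \<longleftrightarrow> le' (f x) (f y))"

definition posets_isomorphic ::
    "'a set \<Rightarrow> ('a \<Rightarrow> 'a \<Rightarrow> bool) \<Rightarrow> 'b set \<Rightarrow> ('b \<Rightarrow> 'b \<Rightarrow> bool) \<Rightarrow> bool" where
  "posets_isomorphic P le Q le' \<longleftrightarrow> (\<exists>f. poset_iso_map f P le Q le')"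

definition order_ideal :: "'a set \<Rightarrow> 'a set \<Rightarrow> ('a \<Rightarrow> 'a \<Rightarrow> bool) \<Rightarrow> bool" where
  "order_ideal I P le \<longleftrightarrow> I \<subseteq> P \<and> (\<forall>x\<in>I. \<forall>y\<in>P. le y x \<longrightarrow> y \<in> I)"


subsection \<open>Chromatic polynomial\<close>

definition proper_colourings :: "'v set set \<Rightarrow> nat \<Rightarrow> ('v \<Rightarrow> nat) set" where
  "proper_colourings E k =
     {f. (\<forall>i. f i < k) \<and> (\<forall>i j. {i, j} \<in> E \<longrightarrow> f i \<noteq> f j)}"

text \<open>
  For a finite simple graph there is exactly one polynomial with this property.
\<close>

definition chromatic_poly :: "'v::finite set set \<Rightarrow> int poly" where
  "chromatic_poly E = (THE p. \<forall>k::nat. poly p (int k) = int (card (proper_colourings E k)))"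

text \<open>The polynomial \<open>t (t - 1) \<cdots> (t - m + 1)\<close>.\<close>

definition falling_factorial_poly :: "nat \<Rightarrow> int poly" where
  "falling_factorial_poly m = (\<Prod>i<m. [:- int i, 1:])"


subsection \<open>Current flow\<close>

definition is_potential ::
    "'v::finite set set \<Rightarrow> 'v set \<Rightarrow> ('v \<Rightarrow> real) \<Rightarrow> ('v set \<Rightarrow> real) \<Rightarrow> (real ^ 'v) \<Rightarrow> bool" where
  "is_potential E B u c h \<longleftrightarrow>
     (\<forall>j\<in>B. h $ j = u j) \<and>
     (\<forall>i. i \<notin> B \<longrightarrow> (\<Sum>j\<in>{j. {i, j} \<in> E}. c {i, j} * (h $ i - h $ j)) = 0)"

text \<open>An orientation is given by its set of arcs; \<open>(i, j)\<close> is an arc from \<open>i\<close> to \<open>j\<close>.\<close>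

definition orientations :: "'v set set \<Rightarrow> ('v \<times> 'v) set set" where
  "orientations E =
     {D. (\<forall>i j. (i, j) \<in> D \<longrightarrow> {i, j} \<in> E) \<and>
         (\<forall>i j. {i, j} \<in> E \<longrightarrow> ((i, j) \<in> D \<longleftrightarrow> (j, i) \<notin> D))}"

definition current_orientations ::
    "'v::finite set set \<Rightarrow> 'v set \<Rightarrow> ('v \<Rightarrow> real) \<Rightarrow> ('v \<times> 'v) set set" where
  "current_orientations E B u =
     {D \<in> orientations E. \<exists>c h. (\<forall>e\<in>E. c e > 0) \<and> is_potential E B u c h \<and>
        (\<forall>i j. {i, j} \<in> E \<longrightarrow> h $ i \<noteq> h $ j) \<and>
        (\<forall>i j. {i, j} \<in> E \<longrightarrow> ((i, j) \<in> D \<longleftrightarrow> h $ i > h $ j))}"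

end

theory Submission
  imports Defs
begin

text \<open>
  Part (i): a flat of the graphic arrangement meets \<open>boundary_space B u\<close> iff its partition is
  boundary-separating, and then the intersection contains a point taking distinct values on
  distinct blocks; this point recovers the partition.

  Part (ii): fix an injective colouring \<open>g\<close> of \<open>B\<close> by \<open>k\<close> colours.  The extensions of \<open>g\<close> that are
  constant wherever a flat \<open>Y\<close> is number \<open>k ^ dim Y\<close>, so Moebius inversion over the intersection
  poset shows that exactly \<open>\<chi>(k)\<close> extensions are proper.  The boundary is a clique of the enlarged
  graph, which leaves \<open>k (k - 1) \<cdots> (k - m + 1)\<close> choices of \<open>g\<close>.

  Part (iii): a chamber is the set of points inducing a given orientation of the edges.  It is bounded
  iff no interior vertex is a local extremum: such a vertex could be moved to infinity, while
  without one the maximum principle applies.  Harmonic functions have no interior extremum;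
  conversely, without one every edge lies on a monotone path between boundary nodes, and
  superposing unit flows along these paths gives conductances for which the given point itself
  is the potential.
\<close>

subsection \<open>Flats and partitions\<close>

lemma extend_inj_on:
  fixes f :: "'a \<Rightarrow> 'b"
  assumes "finite C" "A \<subseteq> C" "inj_on f A" "infinite (UNIV :: 'b set)"
  shows "\<exists>g. inj_on g C \<and> (\<forall>a\<in>A. g a = f a)"
proof -
  have finA: "finite A" using assms finite_subset by blast
  then have "infinite (UNIV - f ` A)" using assms(4) by (simp add: Diff_infinite_finite)
  then obtain T where T: "T \<subseteq> UNIV - f ` A" "finite T" "card T = card (C - A)"
    using infinite_arbitrarily_large by metis
  then obtain h where h: "bij_betw h (C - A) T"
    using assms(1) finite_same_card_bij by (metis finite_Diff)
  let ?g = "\<lambda>a. if a \<in> A then f a else h a"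
  have "inj_on ?g (A \<union> (C - A))"
    using assms(3) h T(1) unfolding bij_betw_def
    by (subst inj_on_Un) (auto simp: inj_on_def)
  moreover have "A \<union> (C - A) = C" using assms(2) by auto
  ultimately show ?thesis by (intro exI[of _ ?g]) auto
qed

section \<open>Flats as edge sets and as connected partitions\<close>

definition edge_flat :: "'v::finite set set \<Rightarrow> (real ^ 'v) set" where
  "edge_flat S = {x. \<forall>i j. {i, j} \<in> S \<longrightarrow> x $ i = x $ j}"

lemma edge_flatI: "(\<And>i j. {i, j} \<in> S \<Longrightarrow> x $ i = x $ j) \<Longrightarrow> x \<in> edge_flat S"
  unfolding edge_flat_def by simp

lemma edge_flatD: "x \<in> edge_flat S \<Longrightarrow> {i, j} \<in> S \<Longrightarrow> x $ i = x $ j"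
  unfolding edge_flat_def by simp

lemma partition_flatI:
  "(\<And>P i j. P \<in> \<pi> \<Longrightarrow> i \<in> P \<Longrightarrow> j \<in> P \<Longrightarrow> x $ i = x $ j) \<Longrightarrow> x \<in> partition_flat \<pi>"
  unfolding partition_flat_def by (intro CollectI ballI)

lemma partition_flatD:
  "x \<in> partition_flat \<pi> \<Longrightarrow> P \<in> \<pi> \<Longrightarrow> i \<in> P \<Longrightarrow> j \<in> P \<Longrightarrow> x $ i = x $ j"
  unfolding partition_flat_def by (drule CollectD, (drule (1) bspec)+)

definition same_block :: "'v set set \<Rightarrow> 'v \<Rightarrow> 'v \<Rightarrow> bool" where
  "same_block \<pi> i j \<longleftrightarrow> (\<exists>P\<in>\<pi>. i \<in> P \<and> j \<in> P)"

lemma simple_graph_edge_neq: "simple_graph E \<Longrightarrow> {i, j} \<in> E \<Longrightarrow> i \<noteq> j"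
  by (auto simp: simple_graph_def dest: bspec)

text \<open>Intersecting every hyperplane with \<open>X\<close> amounts to intersecting the whole
  flat with \<open>X\<close> once. Taking \<open>X\<close> to be \<open>UNIV\<close> or
  \<open>boundary_space B u\<close> treats both arrangements together, and indexing by subsets of
  \<open>E\<close> makes finiteness evident.\<close>

lemma intersections_of_restriction:
  "(\<exists>\<S>\<subseteq>{H \<inter> X | H. H \<in> graphic_arrangement E}. Y = X \<inter> \<Inter>\<S>)
      \<longleftrightarrow> (\<exists>S\<subseteq>E. Y = X \<inter> edge_flat S)"
proof
  assume "\<exists>\<S>\<subseteq>{H \<inter> X | H. H \<in> graphic_arrangement E}. Y = X \<inter> \<Inter>\<S>"
  then obtain \<S> where \<S>: "\<S> \<subseteq> {H \<inter> X | H. H \<in> graphic_arrangement E}" "Y = X \<inter> \<Inter>\<S>" by blast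
  \<comment> \<open>\<open>S\<close> takes in every edge whose restricted hyperplane occurs in the
    family, even if several edges cut the same set from \<open>X\<close>.\<close>
  define S where "S = {e \<in> E. \<exists>i j. e = {i, j} \<and> {x. x $ i = x $ j} \<inter> X \<in> \<S>}"
  have "X \<inter> \<Inter>\<S> = X \<inter> edge_flat S"
  proof (intro equalityI subsetI)
    fix x assume x: "x \<in> X \<inter> \<Inter>\<S>"
    have "x $ i = x $ j" if "{i, j} \<in> S" for i j
    proof -
      obtain a b where "{i, j} = {a, b}" "{x. x $ a = x $ b} \<inter> X \<in> \<S>"
        using \<open>{i, j} \<in> S\<close> unfolding S_def by blast
      then show ?thesis using x by (auto simp: doubleton_eq_iff)
    qed
    then show "x \<in> X \<inter> edge_flat S" using x by (auto simp: edge_flat_def)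
  next
    fix x assume x: "x \<in> X \<inter> edge_flat S"
    have "x \<in> K" if "K \<in> \<S>" for K
    proof -
      obtain i j where "K = {x. x $ i = x $ j} \<inter> X" "{i, j} \<in> E"
        using \<S>(1) \<open>K \<in> \<S>\<close> unfolding graphic_arrangement_def by blast
      then have "{i, j} \<in> S" using that unfolding S_def by blast
      then show ?thesis using x \<open>K = _\<close> by (auto simp: edge_flat_def)
    qed
    then show "x \<in> X \<inter> \<Inter>\<S>" using x by auto
  qed
  moreover have "S \<subseteq> E" by (auto simp: S_def)
  ultimately show "\<exists>S\<subseteq>E. Y = X \<inter> edge_flat S" using \<S>(2) by blast
next
  assume "\<exists>S\<subseteq>E. Y = X \<inter> edge_flat S"
  then obtain S where S: "S \<subseteq> E" "Y = X \<inter> edge_flat S" by blast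
  have "Y = X \<inter> \<Inter>{{x. x $ i = x $ j} \<inter> X | i j. {i, j} \<in> S}"
    unfolding S(2) edge_flat_def by blast
  moreover have "{{x. x $ i = x $ j} \<inter> X | i j. {i, j} \<in> S}
      \<subseteq> {H \<inter> X | H. H \<in> graphic_arrangement E}"
    using S(1) unfolding graphic_arrangement_def by blast
  ultimately show "\<exists>\<S>\<subseteq>{H \<inter> X | H. H \<in> graphic_arrangement E}. Y = X \<inter> \<Inter>\<S>" by blast
qed

lemma dirichlet_poset_eq:
  "intersection_poset (boundary_space B u) (dirichlet_arrangement E B u)
    = {Y. Y \<noteq> {} \<and> (\<exists>S\<subseteq>E. Y = boundary_space B u \<inter> edge_flat S)}"
  unfolding intersection_poset_def dirichlet_arrangement_def intersections_of_restriction ..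

lemma graphic_poset_eq:
  "intersection_poset UNIV (graphic_arrangement E) = edge_flat ` Pow E"
proof -
  have "intersection_poset UNIV (graphic_arrangement E)
      = {Y. Y \<noteq> {} \<and> (\<exists>S\<subseteq>E. Y = edge_flat S)}"
    using intersections_of_restriction[where X = UNIV and E = E]
    unfolding intersection_poset_def by simp
  moreover have "0 \<in> edge_flat S" for S :: "'a set set"
    by (simp add: edge_flat_def)
  ultimately show ?thesis by blast
qed

lemma rtrancl_constant_on:
  assumes "(i, j) \<in> r\<^sup>*" "\<And>a b. (a, b) \<in> r \<Longrightarrow> f a = f b"
  shows "f i = f j"
  using assms(1) by induction (auto dest: assms(2))

text \<open>Connectedness of the blocks is what matters: two vertices of a block are joined by edges
  inside it, so equality along edges propagates to the whole block.\<close>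

lemma partition_flat_eq_edge_flat:
  assumes \<pi>: "\<pi> \<in> connected_partitions E"
  shows "partition_flat \<pi> = edge_flat {e \<in> E. \<exists>P\<in>\<pi>. e \<subseteq> P}"
proof (intro equalityI subsetI)
  fix x assume "x \<in> partition_flat \<pi>"
  then show "x \<in> edge_flat {e \<in> E. \<exists>P\<in>\<pi>. e \<subseteq> P}"
    by (auto simp: partition_flat_def edge_flat_def)
next
  fix x assume x: "x \<in> edge_flat {e \<in> E. \<exists>P\<in>\<pi>. e \<subseteq> P}"
  have "x $ i = x $ j" if "P \<in> \<pi>" "i \<in> P" "j \<in> P" for P i j
  proof (rule rtrancl_constant_on[where f = "($) x"])
    show "(i, j) \<in> {(a, b). a \<in> P \<and> b \<in> P \<and> {a, b} \<in> E}\<^sup>*"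
      using \<pi> that by (auto simp: connected_partitions_def induces_connected_def)
  next
    fix a b assume "(a, b) \<in> {(a, b). a \<in> P \<and> b \<in> P \<and> {a, b} \<in> E}"
    then show "x $ a = x $ b" using \<open>P \<in> \<pi>\<close> by (intro edge_flatD[OF x]) blast
  qed
  then show "x \<in> partition_flat \<pi>" by (rule partition_flatI)
qed

text \<open>The partition consists of the connected components of the graph with edge set
  \<open>S\<close>, obtained as the classes of reachability along \<open>S\<close>. They are
  connected in \<open>E\<close> because \<open>S \<subseteq> E\<close>.\<close>

lemma edge_flat_eq_partition_flat:
  assumes S: "S \<subseteq> E"
  shows "\<exists>\<pi>\<in>connected_partitions E. edge_flat S = partition_flat \<pi>"
proof -
  define r where "r = {(a, b). {a, b} \<in> S}"
  have "sym r" by (auto simp: r_def sym_def insert_commute)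
  then have symr: "sym (r\<^sup>*)" by (rule sym_rtrancl)
  then have eq: "equiv UNIV (r\<^sup>*)"
    by (auto intro!: equivI refl_rtrancl trans_rtrancl)
  define \<pi> where "\<pi> = UNIV // r\<^sup>*"
  have part: "partition_on UNIV \<pi>"
    unfolding \<pi>_def using eq by (rule partition_on_quotient)
  have blk: "\<exists>a. P = {b. (a, b) \<in> r\<^sup>*}" if "P \<in> \<pi>" for P
    using that unfolding \<pi>_def by (auto elim!: quotientE)
  have conn: "induces_connected E P" if "P \<in> \<pi>" for P
  proof -
    obtain a where a: "P = {b. (a, b) \<in> r\<^sup>*}" using blk[OF \<open>P \<in> \<pi>\<close>] by blast
    let ?R = "{(a, b). a \<in> P \<and> b \<in> P \<and> {a, b} \<in> E}"
    \<comment> \<open>A path along \<open>S\<close> starting in the class \<open>P\<close> never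
      leaves it, so it is a path of the subgraph induced on \<open>P\<close>.\<close>
    have path: "(i, j) \<in> ?R\<^sup>*" if "(i, j) \<in> r\<^sup>*" "i \<in> P" for i j
      using that
    proof (induction)
      case base then show ?case by simp
    next
      case (step y z)
      have "y \<in> P" "z \<in> P" using step.hyps step.prems unfolding a
        by (auto intro: rtrancl_trans rtrancl_into_rtrancl)
      then have "(y, z) \<in> ?R" using step.hyps(2) S by (auto simp: r_def)
      then show ?case using step.IH[OF step.prems] by (rule rtrancl_into_rtrancl[rotated])
    qed
    have "(i, j) \<in> r\<^sup>*" if "i \<in> P" "j \<in> P" for i j
    proof -
      have "(i, a) \<in> r\<^sup>*" "(a, j) \<in> r\<^sup>*" using that symr unfolding a by (auto dest: symD)
      then show ?thesis by (rule rtrancl_trans)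
    qed
    moreover have "P \<noteq> {}" using a by auto
    ultimately show ?thesis unfolding induces_connected_def using path by blast
  qed
  have "edge_flat S = partition_flat \<pi>"
  proof (intro equalityI subsetI)
    fix x assume x: "x \<in> edge_flat S"
    have "x $ i = x $ j" if "P \<in> \<pi>" "i \<in> P" "j \<in> P" for P i j
    proof -
      obtain a where a: "P = {b. (a, b) \<in> r\<^sup>*}" using blk[OF \<open>P \<in> \<pi>\<close>] by blast
      have "x $ a = x $ b" if "(a, b) \<in> r\<^sup>*" for b
        using that by (rule rtrancl_constant_on) (use x in \<open>auto simp: r_def edge_flat_def\<close>)
      then show ?thesis using that a by (metis mem_Collect_eq)
    qed
    then show "x \<in> partition_flat \<pi>" by (rule partition_flatI)
  next
    fix x assume x: "x \<in> partition_flat \<pi>"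
    have "x $ i = x $ j" if "{i, j} \<in> S" for i j
    proof -
      have "r\<^sup>* `` {i} \<in> \<pi>" unfolding \<pi>_def by (rule quotientI) simp
      moreover have "i \<in> r\<^sup>* `` {i}" "j \<in> r\<^sup>* `` {i}" using that by (auto simp: r_def)
      ultimately show ?thesis using x by (blast dest: partition_flatD)
    qed
    then show "x \<in> edge_flat S" by (rule edge_flatI)
  qed
  then show ?thesis using part conn by (auto simp: connected_partitions_def)
qed

lemma graphic_poset_eq_partition_flats:
  "intersection_poset UNIV (graphic_arrangement E) = partition_flat ` connected_partitions E"
  unfolding graphic_poset_eq
proof (intro equalityI subsetI)
  fix Y assume "Y \<in> edge_flat ` Pow E"
  then show "Y \<in> partition_flat ` connected_partitions E"
    using edge_flat_eq_partition_flat by blast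
next
  fix Y assume "Y \<in> partition_flat ` connected_partitions E"
  then obtain \<pi> where "\<pi> \<in> connected_partitions E" "Y = partition_flat \<pi>" by blast
  then have "Y = edge_flat {e \<in> E. \<exists>P\<in>\<pi>. e \<subseteq> P}" by (simp add: partition_flat_eq_edge_flat)
  then show "Y \<in> edge_flat ` Pow E" by auto
qed

section \<open>Generic points and the refinement order\<close>

text \<open>Each block receives its own real value. A block meeting \<open>B\<close> has exactly one
  boundary node, which dictates the value; these forced values differ since \<open>u\<close> is
  injective, and the remaining blocks get fresh values.\<close>

lemma generic_point:
  fixes \<pi> :: "'v::finite set set"
  assumes \<pi>: "partition_on UNIV \<pi>" and sep: "boundary_separating B \<pi>" and u: "inj_on u B"
  shows "\<exists>x\<in>boundary_space B u \<inter> partition_flat \<pi>. \<forall>i j. x $ i = x $ j \<longleftrightarrow> same_block \<pi> i j"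
proof -
  define A where "A = {P\<in>\<pi>. P \<inter> B \<noteq> {}}"
  define blk where "blk v = (THE P. P \<in> \<pi> \<and> v \<in> P)" for v
  have ex1: "\<exists>!P. P \<in> \<pi> \<and> v \<in> P" for v
    using \<pi> by (auto simp: partition_on_def disjoint_def)
  have blk: "blk v \<in> \<pi>" "v \<in> blk v" for v
    unfolding blk_def using theI'[OF ex1[of v]] by auto
  have blkI: "blk v = P" if "P \<in> \<pi>" "v \<in> P" for v P
    using ex1 blk that by blast
  have one: "i = j" if "P \<in> \<pi>" "i \<in> P \<inter> B" "j \<in> P \<inter> B" for P i j
    using sep that unfolding boundary_separating_def
    by (metis card_le_Suc0_iff_eq finite One_nat_def)
  \<comment> \<open>For a block in \<open>A\<close>, \<open>b P\<close> is its unique boundary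
    node.\<close>
  define b where "b P = (SOME j. j \<in> P \<inter> B)" for P
  have b: "b P \<in> P \<inter> B" if "P \<in> A" for P
    unfolding b_def by (rule someI_ex) (use that in \<open>auto simp: A_def\<close>)
  have "inj_on (u \<circ> b) A"
  proof (rule inj_onI)
    fix P Q assume PQ: "P \<in> A" "Q \<in> A" "(u \<circ> b) P = (u \<circ> b) Q"
    then have "b P = b Q" using u b[of P] b[of Q] by (auto dest: inj_onD)
    then show "P = Q" using b[of P] b[of Q] PQ ex1[of "b P"] by (auto simp: A_def)
  qed
  moreover have "finite \<pi>" "A \<subseteq> \<pi>" by (auto simp: A_def)
  ultimately obtain g where g: "inj_on g \<pi>" "\<forall>P\<in>A. g P = (u \<circ> b) P"
    using extend_inj_on[of \<pi> A "u \<circ> b"] infinite_UNIV_char_0 by blast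
  define x where "x = (\<chi> v. g (blk v))"
  have "x $ j = u j" if "j \<in> B" for j
  proof -
    have "blk j \<in> A" using blk[of j] that by (auto simp: A_def)
    moreover from this have "b (blk j) = j" using one[of "blk j"] b blk that by blast
    ultimately show ?thesis using g by (simp add: x_def)
  qed
  then have "x \<in> boundary_space B u" by (simp add: boundary_space_def)
  moreover have eq: "x $ i = x $ j \<longleftrightarrow> same_block \<pi> i j" for i j
  proof -
    have "x $ i = x $ j \<longleftrightarrow> blk i = blk j"
      using inj_on_eq_iff[OF g(1) blk(1) blk(1)] by (simp add: x_def)
    also have "\<dots> \<longleftrightarrow> same_block \<pi> i j"
      using blk[of i] blk[of j] blkI unfolding same_block_def by metis
    finally show ?thesis .
  qed
  moreover have "x \<in> partition_flat \<pi>"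
    by (rule partition_flatI) (auto simp: eq same_block_def)
  ultimately show ?thesis by blast
qed

lemma partition_flat_mono:
  assumes "refines UNIV \<pi> \<rho>"
  shows "partition_flat \<rho> \<subseteq> partition_flat \<pi>"
proof
  fix x assume x: "x \<in> partition_flat \<rho>"
  have "x $ i = x $ j" if "P \<in> \<pi>" "i \<in> P" "j \<in> P" for P i j
  proof -
    have "\<exists>Q\<in>\<rho>. P \<subseteq> Q" using assms \<open>P \<in> \<pi>\<close> by (simp add: refines_def)
    then obtain Q where "Q \<in> \<rho>" "P \<subseteq> Q" by (rule bexE)
    then show ?thesis using that by (intro partition_flatD[OF x, of Q]) auto
  qed
  then show "x \<in> partition_flat \<pi>" by (rule partition_flatI)
qed

text \<open>A generic point of the flat of \<open>\<rho>\<close> lies in the flat of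
  \<open>\<pi>\<close>, so it is constant on each block of \<open>\<pi>\<close>. Genericity turns
  equal coordinates into membership in a common block of \<open>\<rho>\<close>.\<close>

lemma refines_if_flat_subset:
  assumes \<pi>: "partition_on UNIV \<pi>" and \<rho>: "partition_on UNIV \<rho>"
    and sep: "boundary_separating B \<rho>" and u: "inj_on u B"
    and sub: "boundary_space B u \<inter> partition_flat \<rho> \<subseteq> partition_flat \<pi>"
  shows "refines UNIV \<pi> \<rho>"
  unfolding refines_def
proof (intro conjI ballI)
  fix P assume P: "P \<in> \<pi>"
  obtain x where x: "x \<in> boundary_space B u \<inter> partition_flat \<rho>"
    "\<And>i j. x $ i = x $ j \<longleftrightarrow> same_block \<rho> i j"
    using generic_point[OF \<rho> sep u] by blast
  obtain i where i: "i \<in> P" using P \<pi> unfolding partition_on_def by fastforce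
  obtain Q where Q: "Q \<in> \<rho>" "i \<in> Q" using \<rho> unfolding partition_on_def by blast
  have "j \<in> Q" if "j \<in> P" for j
  proof -
    have "x $ i = x $ j" using x(1) sub P i that by (blast dest: partition_flatD)
    then obtain Q' where "Q' \<in> \<rho>" "i \<in> Q'" "j \<in> Q'" using x(2) unfolding same_block_def by blast
    then show ?thesis using Q \<rho> unfolding partition_on_def disjoint_def by blast
  qed
  then show "\<exists>Q\<in>\<rho>. P \<subseteq> Q" using Q by blast
qed (use \<pi> \<rho> in auto)

lemma boundary_separating_refines:
  fixes \<pi> :: "'v::finite set set"
  assumes "refines UNIV \<pi> \<rho>" "boundary_separating B \<rho>"
  shows "boundary_separating B \<pi>"
  unfolding boundary_separating_def
proof
  fix P assume "P \<in> \<pi>"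
  then obtain Q where "Q \<in> \<rho>" "P \<subseteq> Q" using assms(1) unfolding refines_def by blast
  moreover from this have "card (P \<inter> B) \<le> card (Q \<inter> B)" by (intro card_mono) auto
  ultimately show "card (P \<inter> B) \<le> 1"
    using assms(2) unfolding boundary_separating_def by fastforce
qed

text \<open>The converse direction is the case \<open>B = {}\<close> of the preceding argument,
  where the boundary space is all of \<open>UNIV\<close> and every partition is
  boundary-separating.\<close>

lemma refines_iff_flat_supset:
  assumes "\<pi> \<in> connected_partitions E" "\<rho> \<in> connected_partitions E"
  shows "refines UNIV \<pi> \<rho> \<longleftrightarrow> partition_flat \<pi> \<supseteq> partition_flat \<rho>"
  using assms partition_flat_mono[of \<pi> \<rho>] refines_if_flat_subset[of \<pi> \<rho> "{}" undefined]
  by (auto simp: connected_partitions_def boundary_separating_def)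

lemma poset_iso_map_partition_flat:
  "poset_iso_map partition_flat (connected_partitions E) (refines UNIV)
    (intersection_poset UNIV (graphic_arrangement E)) (\<supseteq>)"
proof -
  have "inj_on partition_flat (connected_partitions E)"
    using refines_iff_flat_supset refines_asym by (metis inj_onI order_refl)
  then show ?thesis
    unfolding poset_iso_map_def bij_betw_def graphic_poset_eq_partition_flats
    using refines_iff_flat_supset by blast
qed

lemma order_ideal_boundary_separating:
  fixes E :: "'v::finite set set"
  shows "order_ideal
    (partition_flat ` {\<pi> \<in> connected_partitions E. boundary_separating B \<pi>})
    (intersection_poset UNIV (graphic_arrangement E)) (\<supseteq>)"
  unfolding order_ideal_def graphic_poset_eq_partition_flats
  using refines_iff_flat_supset boundary_separating_refines by blast

lemma posets_isomorphic_sym: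
  assumes "posets_isomorphic P le Q le'"
  shows "posets_isomorphic Q le' P le"
proof -
  obtain f where f: "bij_betw f P Q" "\<And>x y. x \<in> P \<Longrightarrow> y \<in> P \<Longrightarrow> le x y \<longleftrightarrow> le' (f x) (f y)"
    using assms unfolding posets_isomorphic_def poset_iso_map_def by blast
  have "le' x y \<longleftrightarrow> le (inv_into P f x) (inv_into P f y)" if "x \<in> Q" "y \<in> Q" for x y
    using f that by (metis bij_betw_imp_surj_on f_inv_into_f inv_into_into)
  then show ?thesis using bij_betw_inv_into[OF f(1)]
    unfolding posets_isomorphic_def poset_iso_map_def by blast
qed

text \<open>Two boundary nodes in one block would carry the same coordinate, hence the same value of
  the injective \<open>u\<close>.\<close>

lemma boundary_separating_if_meets:
  fixes \<pi> :: "'v::finite set set"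
  assumes "inj_on u B" "x \<in> boundary_space B u \<inter> partition_flat \<pi>"
  shows "boundary_separating B \<pi>"
  unfolding boundary_separating_def
proof
  fix P assume "P \<in> \<pi>"
  have "i = j" if "i \<in> P \<inter> B" "j \<in> P \<inter> B" for i j
  proof -
    have "x $ i = x $ j" using assms(2) \<open>P \<in> \<pi>\<close> that by (blast dest: partition_flatD)
    then have "u i = u j" using assms(2) that by (simp add: boundary_space_def)
    then show ?thesis using assms(1) that by (auto dest: inj_onD)
  qed
  then show "card (P \<inter> B) \<le> 1" using card_le_Suc0_iff_eq[of "P \<inter> B"] by simp
qed

text \<open>The isomorphism is built from the order ideal to the Dirichlet poset, as
  \<open>F \<mapsto> X \<inter> F\<close>, and then inverted. Generic points show that the image is
  nonempty and that the order is reflected; a flat that meets \<open>X\<close> has a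
  boundary-separating partition, which gives surjectivity.\<close>

lemma dirichlet_poset_isomorphic:
  fixes E :: "'v::finite set set"
  assumes u: "inj_on u B"
  shows "posets_isomorphic
    (intersection_poset (boundary_space B u) (dirichlet_arrangement E B u)) (\<supseteq>)
    (partition_flat ` {\<pi> \<in> connected_partitions E. boundary_separating B \<pi>}) (\<supseteq>)"
proof (rule posets_isomorphic_sym)
  let ?X = "boundary_space B u"
  let ?I = "partition_flat ` {\<pi> \<in> connected_partitions E. boundary_separating B \<pi>}"
  let ?L = "intersection_poset ?X (dirichlet_arrangement E B u)"
  let ?f = "\<lambda>F. ?X \<inter> F"
  have ord: "F \<supseteq> G \<longleftrightarrow> ?f F \<supseteq> ?f G" if "F \<in> ?I" "G \<in> ?I" for F G
  proof
    assume *: "?f F \<supseteq> ?f G"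
    obtain \<pi> \<rho> where \<pi>: "\<pi> \<in> connected_partitions E" "F = partition_flat \<pi>"
      and \<rho>: "\<rho> \<in> connected_partitions E" "boundary_separating B \<rho>" "G = partition_flat \<rho>"
      using that \<open>F \<in> ?I\<close> \<open>G \<in> ?I\<close> by blast
    have "refines UNIV \<pi> \<rho>"
      by (rule refines_if_flat_subset[OF _ _ \<rho>(2) u])
         (use * \<pi> \<rho> in \<open>auto simp: connected_partitions_def\<close>)
    then show "F \<supseteq> G" using partition_flat_mono \<pi> \<rho> by blast
  qed auto
  have "?f ` ?I = ?L"
  proof (intro equalityI subsetI)
    fix Y assume "Y \<in> ?f ` ?I"
    then obtain \<pi> where \<pi>: "\<pi> \<in> connected_partitions E" "boundary_separating B \<pi>"
      "Y = ?X \<inter> partition_flat \<pi>" by blast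
    have "Y \<noteq> {}" using generic_point[OF _ \<pi>(2) u] \<pi> by (auto simp: connected_partitions_def)
    moreover have "Y = ?X \<inter> edge_flat {e \<in> E. \<exists>P\<in>\<pi>. e \<subseteq> P}"
      using \<pi> by (simp add: partition_flat_eq_edge_flat)
    moreover have "{e \<in> E. \<exists>P\<in>\<pi>. e \<subseteq> P} \<subseteq> E" by blast
    ultimately show "Y \<in> ?L" unfolding dirichlet_poset_eq 
      by (intro CollectI conjI exI[of _ "{e \<in> E. \<exists>P\<in>\<pi>. e \<subseteq> P}"])
  next
    fix Y assume "Y \<in> ?L"
    then obtain S where S: "Y \<noteq> {}" "S \<subseteq> E" "Y = ?X \<inter> edge_flat S"
      unfolding dirichlet_poset_eq by blast
    then obtain \<pi> where \<pi>: "\<pi> \<in> connected_partitions E" "edge_flat S = partition_flat \<pi>"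
      using edge_flat_eq_partition_flat by blast
    then have "boundary_separating B \<pi>" using S boundary_separating_if_meets[OF u] by blast
    then show "Y \<in> ?f ` ?I" using \<pi> S by blast
  qed
  moreover have "inj_on ?f ?I"
  proof (rule inj_onI)
    fix F G assume "F \<in> ?I" "G \<in> ?I" "?f F = ?f G"
    then show "F = G" using ord[of F G] ord[of G F] by simp
  qed
  ultimately have "poset_iso_map ?f ?I (\<supseteq>) ?L (\<supseteq>)"
    unfolding poset_iso_map_def bij_betw_def using ord by blast
  then show "posets_isomorphic ?I (\<supseteq>) ?L (\<supseteq>)" unfolding posets_isomorphic_def by blast
qed

subsection \<open>The characteristic polynomial\<close>

text \<open>This is the recursion defining \<open>moebius\<close> with the term of \<open>Y\<close>
  moved to the other side; \<open>X\<close> is the bottom element of \<open>L\<close> under reverse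
  inclusion.\<close>

lemma sum_moebius:
  assumes L: "finite L" "X \<in> L" "Y \<in> L" "\<And>Z. Z \<in> L \<Longrightarrow> Z \<subseteq> X"
  shows "(\<Sum>Z\<in>{Z\<in>L. Y \<subseteq> Z}. moebius L X Z) = of_bool (Y = X)"
proof (cases "Y = X")
  case True
  then have "{Z\<in>L. Y \<subseteq> Z} = {X}" using L by blast
  then show ?thesis using True L by (simp add: moebius.simps)
next
  case False
  have "{Z\<in>L. Y \<subseteq> Z} = insert Y {Z\<in>L. Y \<subset> Z \<and> Z \<subseteq> X}" using L(3,4) by blast
  moreover have "moebius L X Y = - (\<Sum>Z\<in>{Z\<in>L. Y \<subset> Z \<and> Z \<subseteq> X}. moebius L X Z)"
    using False L by (subst moebius.simps) simp
  ultimately show ?thesis using False L(1) by simp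
qed

text \<open>The map \<open>r\<close> picks a representative in each class of vertices, with boundary
  nodes representing themselves. A point of the flat is freely determined by its coordinates at
  interior representatives.\<close>

lemma aff_dim_representative_flat:
  fixes r :: "'v::finite \<Rightarrow> 'v"
  assumes r: "\<And>v. r (r v) = r v" "\<And>b. b \<in> B \<Longrightarrow> r b = b"
  shows "aff_dim {x \<in> boundary_space B u. \<forall>v. x $ v = x $ r v} = int (card {v. v \<notin> B \<and> r v = v})"
proof -
  let ?R = "{v. v \<notin> B \<and> r v = v}"
  let ?W' = "{x :: real ^ 'v. \<forall>i. i \<notin> ?R \<longrightarrow> x $ i = 0}"
  let ?W = "{x :: real ^ 'v. (\<forall>b\<in>B. x $ b = 0) \<and> (\<forall>v. x $ v = x $ r v)}"
  let ?T = "\<lambda>x :: real ^ 'v. \<chi> v. x $ r v"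
  \<comment> \<open>A base point of the flat. As \<open>u\<close> is a total function,
    \<open>u (r v)\<close> is also available at interior representatives.\<close>
  define p :: "real ^ 'v" where "p = (\<chi> v. u (r v))"
  have p: "p $ v = p $ r v" "b \<in> B \<Longrightarrow> p $ b = u b" for v b using r by (auto simp: p_def)
  have "{x \<in> boundary_space B u. \<forall>v. x $ v = x $ r v} = (+) p ` ?W"
  proof (intro equalityI subsetI)
    fix x assume x: "x \<in> {x \<in> boundary_space B u. \<forall>v. x $ v = x $ r v}"
    have "(x - p) $ v = (x - p) $ r v" for v
      using x p(1)[of v] unfolding vector_minus_component by (metis (mono_tags, lifting) mem_Collect_eq)
    moreover have "(x - p) $ b = 0" if "b \<in> B" for b
      using x p(2)[OF that] that by (simp add: boundary_space_def)
    ultimately have "x - p \<in> ?W" by blast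
    then show "x \<in> (+) p ` ?W" by (intro image_eqI[of _ _ "x - p"]) simp
  next
    fix x assume "x \<in> (+) p ` ?W"
    then obtain w where w: "x = p + w" "\<And>b. b \<in> B \<Longrightarrow> w $ b = 0" "\<And>v. w $ v = w $ r v" by blast
    have "x $ v = x $ r v" for v using w(3)[of v] p(1)[of v] unfolding w(1) by simp
    moreover have "x \<in> boundary_space B u" using w(2) p(2) unfolding w(1) boundary_space_def by simp
    ultimately show "x \<in> {x \<in> boundary_space B u. \<forall>v. x $ v = x $ r v}" by blast
  qed
  \<comment> \<open>The direction space is parametrised by the coordinate subspace
    \<open>?W'\<close> of the interior representatives: \<open>?T\<close> copies the value at a
    representative to its whole class.\<close>
  moreover have W: "?W = ?T ` ?W'"
  proof (intro equalityI subsetI)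
    fix x assume "x \<in> ?W"
    then have x: "\<And>b. b \<in> B \<Longrightarrow> x $ b = 0" "\<And>v. x $ v = x $ r v" by blast+
    let ?y = "\<chi> v. if v \<in> ?R then x $ v else 0"
    have "x $ v = ?T ?y $ v" for v
      using x(1)[of "r v"] x(2)[of v] r(1)[of v] by simp
    then have "x = ?T ?y" unfolding vec_eq_iff by blast
    moreover have "?y \<in> ?W'" by simp
    ultimately show "x \<in> ?T ` ?W'" by (rule image_eqI)
  qed (use r in auto)
  moreover have lin: "linear ?T" by (auto intro!: linearI simp: vec_eq_iff)
  have sub: "subspace ?W'" by (auto simp: subspace_def)
  have "inj_on ?T (span ?W')"
    unfolding span_eq_iff[THEN iffD2, OF sub]
  proof (rule inj_onI)
    fix x y assume xy: "x \<in> ?W'" "y \<in> ?W'" "?T x = ?T y"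
    have "x $ v = y $ v" for v
    proof (cases "v \<in> ?R")
      case True
      have "?T x $ v = ?T y $ v" using xy(3) by simp
      then show ?thesis using True by simp
    qed (use xy in auto)
    then show "x = y" by (simp add: vec_eq_iff)
  qed
  with lin have "dim (?T ` ?W') = dim ?W'" by (rule dim_image_eq)
  moreover have "dim ?W' = card ?R"
    using dim_substandard_cart[where 'a = real, of ?R] by (simp only: dim_vec_eq)
  moreover have "subspace ?W" unfolding W using lin sub by (rule linear_subspace_image)
  ultimately show ?thesis by (simp only: aff_dim_translation_eq aff_dim_subspace)
qed

text \<open>The discrete counterpart of the dimension count: a colouring constant on classes is the
  same as a free choice of colours at the interior representatives, so the same cardinality appears
  as exponent.\<close>

lemma card_representative_functions:
  fixes r :: "'v::finite \<Rightarrow> 'v" and k :: nat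
  assumes r: "\<And>v. r (r v) = r v" "\<And>b. b \<in> B \<Longrightarrow> r b = b" and g: "\<And>b. b \<in> B \<Longrightarrow> g b < k"
  shows "card {f. (\<forall>v. f v < k) \<and> (\<forall>b\<in>B. f b = g b) \<and> (\<forall>v. f v = f (r v))}
    = k ^ card {v. v \<notin> B \<and> r v = v}"
proof -
  let ?R = "{v. v \<notin> B \<and> r v = v}"
  let ?F = "{f. (\<forall>v. f v < k) \<and> (\<forall>b\<in>B. f b = g b) \<and> (\<forall>v. f v = f (r v))}"
  \<comment> \<open>Inverse of restriction: a class represented by a boundary node is coloured by
    \<open>g\<close>, any other class by \<open>h\<close> at its representative.\<close>
  let ?ext = "\<lambda>h v. if r v \<in> B then g (r v) else h (r v)"
  have "bij_betw (\<lambda>f. restrict f ?R) ?F (?R \<rightarrow>\<^sub>E {..<k})"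
  proof (rule bij_betw_byWitness[where f' = ?ext])
    show "\<forall>f\<in>?F. ?ext (restrict f ?R) = f"
    proof (intro ballI ext)
      fix f v assume f: "f \<in> ?F"
      then have "f v = f (r v)" by blast
      then show "?ext (restrict f ?R) v = f v" using f r(1)[of v] by auto
    qed
    show "\<forall>h\<in>?R \<rightarrow>\<^sub>E {..<k}. restrict (?ext h) ?R = h"
      by (auto simp: fun_eq_iff PiE_def extensional_def)
    show "(\<lambda>f. restrict f ?R) ` ?F \<subseteq> ?R \<rightarrow>\<^sub>E {..<k}"
      by (intro image_subsetI restrict_PiE_iff[THEN iffD2]) auto
    show "?ext ` (?R \<rightarrow>\<^sub>E {..<k}) \<subseteq> ?F"
    proof (rule image_subsetI)
      fix h assume h: "h \<in> ?R \<rightarrow>\<^sub>E {..<k}"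
      have "?ext h v < k" for v
        using g[of "r v"] h r(1)[of v] by (auto dest: PiE_mem)
      moreover have "?ext h v = ?ext h (r v)" for v using r(1)[of v] by simp
      moreover have "?ext h b = g b" if "b \<in> B" for b using r(2)[OF that] that by simp
      ultimately show "?ext h \<in> ?F" by blast
    qed
  qed
  then have "card ?F = card (?R \<rightarrow>\<^sub>E {..<k})" by (rule bij_betw_same_card)
  then show ?thesis by (simp add: card_PiE)
qed

text \<open>Vertices are put in one class when their coordinates agree throughout \<open>Y\<close>.
  A single choice of representatives then computes both the dimension of \<open>Y\<close> and the
  number of colourings compatible with \<open>Y\<close>.\<close>

lemma card_flat_colourings:
  fixes g :: "'v::finite \<Rightarrow> nat"
  assumes Y: "Y = boundary_space B u \<inter> edge_flat S" "Y \<noteq> {}" and u: "inj_on u B"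
    and g: "\<And>b. b \<in> B \<Longrightarrow> g b < k"
  shows "card {f. (\<forall>v. f v < k) \<and> (\<forall>b\<in>B. f b = g b) \<and>
      (\<forall>i j. (\<forall>x\<in>Y. x $ i = x $ j) \<longrightarrow> f i = f j)} = k ^ nat (aff_dim Y)"
proof -
  define cls where "cls v = {w. \<forall>x\<in>Y. x $ w = x $ v}" for v
  \<comment> \<open>Boundary nodes are preferred as representatives, so that only classes disjoint
    from \<open>B\<close> contribute to the dimension.\<close>
  define r where "r v = (if cls v \<inter> B \<noteq> {} then SOME b. b \<in> cls v \<inter> B else SOME w. w \<in> cls v)" for v
  have cls_self: "v \<in> cls v" for v by (simp add: cls_def)
  have r_cls: "r v \<in> cls v" for v
  proof (cases "cls v \<inter> B = {}")
    case True
    then show ?thesis using someI[of "\<lambda>w. w \<in> cls v", OF cls_self] by (simp add: r_def)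
  next
    case False
    then have "(SOME b. b \<in> cls v \<inter> B) \<in> cls v \<inter> B" using some_in_eq by blast
    then show ?thesis using False by (simp add: r_def)
  qed
  have cls_eq: "cls i = cls j" if "i \<in> cls j" for i j using that by (auto simp: cls_def)
  then have r_eq: "r i = r j" if "i \<in> cls j" for i j using that by (simp add: r_def)
  have r1: "r (r v) = r v" for v using r_eq r_cls by blast
  have Yr: "x $ r v = x $ v" if "x \<in> Y" for x v using r_cls[of v] that by (simp add: cls_def)
  \<comment> \<open>At a point of \<open>Y\<close>, two boundary nodes of one class have equal
    coordinates, hence equal values of \<open>u\<close>; so a class contains at most one of
    them.\<close>
  have r2: "r b = b" if b: "b \<in> B" for b
  proof -
    have "cls b \<inter> B \<noteq> {}" using cls_self b by blast
    then have "r b \<in> B" using some_in_eq[of "cls b \<inter> B"] by (auto simp: r_def)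
    obtain x where x: "x \<in> Y" using Y(2) by blast
    then have "u (r b) = u b" using Yr[OF x, of b] \<open>r b \<in> B\<close> b Y(1) by (simp add: boundary_space_def)
    then show ?thesis using u \<open>r b \<in> B\<close> b by (auto dest: inj_onD)
  qed
  have "Y = {x \<in> boundary_space B u. \<forall>v. x $ v = x $ r v}"
  proof (intro equalityI subsetI)
    fix x assume x: "x \<in> Y"
    then show "x \<in> {x \<in> boundary_space B u. \<forall>v. x $ v = x $ r v}"
      using Yr[OF x] Y(1) by simp
  next
    fix x assume x: "x \<in> {x \<in> boundary_space B u. \<forall>v. x $ v = x $ r v}"
    have "x \<in> edge_flat S"
    proof (rule edge_flatI)
      fix i j assume "{i, j} \<in> S"
      then have "i \<in> cls j" unfolding cls_def Y(1) by (auto dest: edge_flatD)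
      then have "r i = r j" by (rule r_eq)
      moreover have "x $ i = x $ r i" "x $ j = x $ r j" using x by blast+
      ultimately show "x $ i = x $ j" by simp
    qed
    then show "x \<in> Y" using x Y(1) by blast
  qed
  then have "aff_dim Y = int (card {v. v \<notin> B \<and> r v = v})"
    using aff_dim_representative_flat[of r B u, OF r1 r2] by simp
  moreover have "(\<forall>i j. (\<forall>x\<in>Y. x $ i = x $ j) \<longrightarrow> f i = f j) \<longleftrightarrow> (\<forall>v. f v = f (r v))"
    for f :: "'v \<Rightarrow> nat"
  proof
    assume *: "\<forall>i j. (\<forall>x\<in>Y. x $ i = x $ j) \<longrightarrow> f i = f j"
    have "\<forall>x\<in>Y. x $ v = x $ r v" for v using Yr by simp
    then show "\<forall>v. f v = f (r v)" using * by blast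
  next
    assume *: "\<forall>v. f v = f (r v)"
    show "\<forall>i j. (\<forall>x\<in>Y. x $ i = x $ j) \<longrightarrow> f i = f j"
    proof (intro allI impI)
      fix i j assume "\<forall>x\<in>Y. x $ i = x $ j"
      then have "r i = r j" by (intro r_eq) (simp add: cls_def)
      then show "f i = f j" using * by metis
    qed
  qed
  ultimately show ?thesis using card_representative_functions[of r B g k, OF r1 r2 g] by simp
qed

text \<open>Evaluating at \<open>k\<close> replaces each power \<open>k ^ dim Y\<close> by the
  number of extensions of \<open>g\<close> compatible with \<open>Y\<close>. Exchanging the sums
  over flats and colourings leaves, for each colouring \<open>f\<close>, a Moebius sum over the
  flats containing \<open>Z f\<close>, which is 1 if \<open>Z f = X\<close> and 0 otherwise.\<close>

lemma poly_characteristic_dirichlet: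
  fixes g :: "'v::finite \<Rightarrow> nat"
  assumes E: "simple_graph E" and nadj: "\<forall>i\<in>B. \<forall>j\<in>B. {i, j} \<notin> E" and u: "inj_on u B"
    and g: "\<And>b. b \<in> B \<Longrightarrow> g b < k" "inj_on g B"
  shows "poly (characteristic_poly (boundary_space B u) (dirichlet_arrangement E B u)) (int k)
    = int (card {f. (\<forall>v. f v < k) \<and> (\<forall>b\<in>B. f b = g b) \<and> (\<forall>i j. {i, j} \<in> E \<longrightarrow> f i \<noteq> f j)})"
proof -
  define X where "X = boundary_space B u"
  define L where "L = intersection_poset X (dirichlet_arrangement E B u)"
  define F where "F = {f. (\<forall>v. f v < k) \<and> (\<forall>b\<in>B. f b = g b)}"
  define A where "A Y = {f \<in> F. \<forall>i j. (\<forall>x\<in>Y. x $ i = x $ j) \<longrightarrow> f i = f j}" for Y :: "(real ^ 'v) set"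
  \<comment> \<open>\<open>Z f\<close> is the flat cut out by the monochromatic edges of
    \<open>f\<close>. It equals \<open>X\<close> exactly when \<open>f\<close> is proper on
    \<open>E\<close>.\<close>
  define Z where "Z f = X \<inter> edge_flat {e \<in> E. \<exists>c. \<forall>v\<in>e. f v = c}" for f :: "'v \<Rightarrow> nat"
  have L_eq: "L = {Y. Y \<noteq> {} \<and> (\<exists>S\<subseteq>E. Y = X \<inter> edge_flat S)}"
    unfolding L_def X_def using dirichlet_poset_eq .
  have "L \<subseteq> (\<lambda>S. X \<inter> edge_flat S) ` Pow E" unfolding L_eq by blast
  then have finL: "finite L" by (rule finite_subset) simp
  have sub: "Y \<subseteq> X" if "Y \<in> L" for Y using that unfolding L_eq by blast
  have finF: "finite F"
  proof (rule finite_subset)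
    show "F \<subseteq> UNIV \<rightarrow>\<^sub>E {..<k}" by (auto simp: F_def)
  qed (simp add: finite_PiE)
  \<comment> \<open>Colours become real coordinates through an injection \<open>\<phi>\<close> with
    \<open>\<phi> (g b) = u b\<close> for boundary nodes \<open>b\<close>. The resulting point of
    \<open>X\<close> has exactly the coincidences of \<open>f\<close>.\<close>
  have generic: "\<exists>x\<in>X. \<forall>i j. x $ i = x $ j \<longleftrightarrow> f i = f j" if f: "f \<in> F" for f
  proof -
    have "inj_on (u \<circ> inv_into B g) (g ` B)"
      using g(2) u by (auto intro!: inj_onI dest: inj_onD)
    moreover have "g ` B \<subseteq> {..<k}" using g(1) by auto
    ultimately obtain \<phi> where \<phi>: "inj_on \<phi> {..<k}" "\<forall>a\<in>g ` B. \<phi> a = (u \<circ> inv_into B g) a"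
      using extend_inj_on[of "{..<k}" "g ` B" "u \<circ> inv_into B g"] infinite_UNIV_char_0 by blast
    let ?x = "\<chi> v. \<phi> (f v)"
    have "?x \<in> X" using f \<phi>(2) g(2) by (auto simp: X_def boundary_space_def F_def)
    moreover have "?x $ i = ?x $ j \<longleftrightarrow> f i = f j" for i j
      using f inj_on_eq_iff[OF \<phi>(1)] by (simp add: F_def)
    ultimately show ?thesis by blast
  qed
  have mono: "x \<in> Z f" if "x \<in> X" "\<forall>i j. x $ i = x $ j \<longleftrightarrow> f i = f j" for x f
  proof -
    have "x \<in> edge_flat {e \<in> E. \<exists>c. \<forall>v\<in>e. f v = c}"
    proof (rule edge_flatI)
      fix i j assume "{i, j} \<in> {e \<in> E. \<exists>c. \<forall>v\<in>e. f v = c}"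
      then have "f i = f j" by auto
      then show "x $ i = x $ j" using that(2) by simp
    qed
    then show ?thesis using that(1) by (simp add: Z_def)
  qed
  have ZL: "Z f \<in> L" if "f \<in> F" for f
  proof -
    have "Z f \<noteq> {}" using generic[OF that] mono by blast
    moreover have "\<exists>S\<subseteq>E. Z f = X \<inter> edge_flat S"
      unfolding Z_def by (intro exI[of _ "{e \<in> E. \<exists>c. \<forall>v\<in>e. f v = c}"] conjI) auto
    ultimately show ?thesis unfolding L_eq by simp
  qed
  have A_iff: "f \<in> A Y \<longleftrightarrow> Z f \<subseteq> Y" if f: "f \<in> F" and Y: "Y \<in> L" for f Y
  proof
    assume fA: "f \<in> A Y"
    obtain S where S: "S \<subseteq> E" "Y = X \<inter> edge_flat S" using Y unfolding L_eq by blast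
    show "Z f \<subseteq> Y"
    proof
      fix x assume x: "x \<in> Z f"
      have "x \<in> edge_flat S"
      proof (rule edge_flatI)
        fix i j assume ij: "{i, j} \<in> S"
        have "\<forall>x\<in>Y. x $ i = x $ j" using ij unfolding S(2) by (auto dest: edge_flatD)
        then have "f i = f j" using fA unfolding A_def by blast
        then have "{i, j} \<in> {e \<in> E. \<exists>c. \<forall>v\<in>e. f v = c}" using ij S(1) by auto
        then show "x $ i = x $ j" using x unfolding Z_def by (auto dest: edge_flatD)
      qed
      then show "x \<in> Y" using x unfolding S(2) Z_def by blast
    qed
  next
    assume "Z f \<subseteq> Y"
    moreover obtain x where x: "x \<in> X" "\<forall>i j. x $ i = x $ j \<longleftrightarrow> f i = f j" using generic[OF f] by blast
    ultimately have "x \<in> Y" using mono by blast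
    then have "f i = f j" if "\<forall>x\<in>Y. x $ i = x $ j" for i j using that x(2) by blast
    then show "f \<in> A Y" using f unfolding A_def by blast
  qed
  have XL: "X \<in> L"
  proof -
    have "X \<inter> edge_flat {} = X" by (simp add: edge_flat_def)
    moreover have "(\<chi> v. u v) \<in> X" by (simp add: X_def boundary_space_def)
    ultimately show ?thesis unfolding L_eq by blast
  qed
  have Z_eq_X: "Z f = X \<longleftrightarrow> (\<forall>i j. {i, j} \<in> E \<longrightarrow> f i \<noteq> f j)" for f
  proof
    assume ZX: "Z f = X"
    show "\<forall>i j. {i, j} \<in> E \<longrightarrow> f i \<noteq> f j"
    proof (intro allI impI notI)
      fix i j assume ij: "{i, j} \<in> E" "f i = f j"
      have "i \<notin> B \<or> j \<notin> B" using nadj ij(1) by blast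
      then obtain a b where ab: "{a, b} = {i, j}" "a \<notin> B" by blast
      have "a \<noteq> b" using simple_graph_edge_neq[OF E, of a b] ab ij by simp
      \<comment> \<open>No edge joins two boundary nodes, so an endpoint \<open>a\<close> is
        interior and can be moved off the value at \<open>b\<close>. This point of \<open>X\<close>
        violates the equation of the edge.\<close>
      let ?x = "\<chi> v. if v = a then u b + 1 else u v"
      have "?x \<in> X" using ab(2) by (auto simp: X_def boundary_space_def)
      then have "?x \<in> edge_flat {e \<in> E. \<exists>c. \<forall>v\<in>e. f v = c}" using ZX unfolding Z_def by blast
      moreover have "{a, b} \<in> {e \<in> E. \<exists>c. \<forall>v\<in>e. f v = c}" using ab(1) ij by auto
      ultimately have "?x $ a = ?x $ b" by (rule edge_flatD)
      then show False using \<open>a \<noteq> b\<close> by simp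
    qed
  next
    assume *: "\<forall>i j. {i, j} \<in> E \<longrightarrow> f i \<noteq> f j"
    have "{i, j} \<notin> {e \<in> E. \<exists>c. \<forall>v\<in>e. f v = c}" for i j
    proof
      assume "{i, j} \<in> {e \<in> E. \<exists>c. \<forall>v\<in>e. f v = c}"
      then have "{i, j} \<in> E" "f i = f j" by auto
      then show False using * by blast
    qed
    then have "edge_flat {e \<in> E. \<exists>c. \<forall>v\<in>e. f v = c} = UNIV" unfolding edge_flat_def by blast
    then show "Z f = X" by (simp add: Z_def)
  qed
  have cardA: "card (A Y) = k ^ nat (aff_dim Y)" if "Y \<in> L" for Y
  proof -
    obtain S where "Y = boundary_space B u \<inter> edge_flat S" "Y \<noteq> {}"
      using \<open>Y \<in> L\<close> unfolding L_eq X_def by blast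
    from card_flat_colourings[OF this u g(1)] show ?thesis
      by (simp add: A_def F_def conj_assoc)
  qed
  have "poly (characteristic_poly X (dirichlet_arrangement E B u)) (int k)
      = (\<Sum>Y\<in>L. moebius L X Y * int (card (A Y)))"
    unfolding characteristic_poly_def L_def[symmetric]
    by (simp add: poly_sum poly_monom cardA)
  also have "\<dots> = (\<Sum>Y\<in>L. \<Sum>f\<in>F. if Z f \<subseteq> Y then moebius L X Y else 0)"
  proof (rule sum.cong[OF refl])
    fix Y assume Y: "Y \<in> L"
    have "A Y = {f \<in> F. Z f \<subseteq> Y}" using A_iff[OF _ Y] by (auto simp: A_def)
    then have "int (card (A Y)) = (\<Sum>f\<in>F. if Z f \<subseteq> Y then 1 else 0)"
      using finF by (simp add: sum.If_cases Int_def)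
    then show "moebius L X Y * int (card (A Y)) = (\<Sum>f\<in>F. if Z f \<subseteq> Y then moebius L X Y else 0)"
      by (simp add: sum_distrib_left if_distrib cong: if_cong)
  qed
  also have "\<dots> = (\<Sum>f\<in>F. \<Sum>Y\<in>L. if Z f \<subseteq> Y then moebius L X Y else 0)" by (rule sum.swap)
  also have "\<dots> = (\<Sum>f\<in>F. of_bool (Z f = X))"
  proof (rule sum.cong[OF refl])
    fix f assume "f \<in> F"
    then show "(\<Sum>Y\<in>L. if Z f \<subseteq> Y then moebius L X Y else 0) = of_bool (Z f = X)"
      using sum_moebius[OF finL XL ZL sub, of f] finL
      by (simp add: sum.inter_filter)
  qed
  also have "\<dots> = int (card {f \<in> F. Z f = X})"
    using finF by (simp add: of_bool_def sum.If_cases Int_def)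
  finally show ?thesis unfolding X_def[symmetric] Z_eq_X F_def by (simp add: conj_assoc)
qed

section \<open>Chromatic polynomial of the enlarged graph\<close>

text \<open>The right-hand side is the number of injections from an \<open>m\<close>-set into
  \<open>k\<close> colours, with truncated subtraction. If \<open>m \<le> k\<close> nothing is
  truncated; otherwise the factor with index \<open>k\<close> makes both sides vanish.\<close>

lemma poly_falling_factorial:
  "poly (falling_factorial_poly m) (int k) = int (prod ((-) k) {0..<m})"
proof (cases "m \<le> k")
  case True
  have "poly (falling_factorial_poly m) (int k) = (\<Prod>i\<in>{0..<m}. int k - int i)"
    by (simp add: falling_factorial_poly_def poly_prod lessThan_atLeast0)
  also have "\<dots> = (\<Prod>i\<in>{0..<m}. int (k - i))"
    using True by (intro prod.cong) (auto simp: of_nat_diff)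
  finally show ?thesis by simp
next
  case False
  then have "(\<Prod>i<m. int k - int i) = 0" "prod ((-) k) {0..<m} = 0"
    by (auto simp: prod_zero_iff intro!: bexI[of _ k])
  moreover have "poly (falling_factorial_poly m) (int k) = (\<Prod>i<m. int k - int i)"
    by (simp add: falling_factorial_poly_def poly_prod)
  ultimately show ?thesis by linarith
qed

text \<open>Proper colourings are sorted by their restriction to \<open>B\<close>, which the added
  clique forces to be injective. By hypothesis each injective restriction has the same number
  \<open>n\<close> of extensions.\<close>

lemma card_proper_colourings_add_clique:
  fixes E :: "'v::finite set set"
  assumes N: "\<And>g. (\<And>b. b \<in> B \<Longrightarrow> g b < k) \<Longrightarrow> inj_on g B \<Longrightarrow>
    card {f. (\<forall>v. f v < k) \<and> (\<forall>b\<in>B. f b = g b) \<and> (\<forall>i j. {i, j} \<in> E \<longrightarrow> f i \<noteq> f j)} = n"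
  shows "card (proper_colourings (add_clique E B) k) = prod ((-) k) {0..<card B} * n"
proof -
  let ?I = "{g \<in> B \<rightarrow>\<^sub>E {..<k}. inj_on g B}"
  let ?N = "\<lambda>g. {f. (\<forall>v. f v < k) \<and> (\<forall>b\<in>B. f b = g b) \<and> (\<forall>i j. {i, j} \<in> E \<longrightarrow> f i \<noteq> f j)}"
  have proper: "f \<in> proper_colourings (add_clique E B) k \<longleftrightarrow>
    (\<forall>v. f v < k) \<and> (\<forall>i j. {i, j} \<in> E \<longrightarrow> f i \<noteq> f j) \<and> inj_on f B" for f
  proof -
    have "{i, j} \<in> {{a, b} | a b. a \<in> B \<and> b \<in> B \<and> a \<noteq> b} \<longleftrightarrow> i \<in> B \<and> j \<in> B \<and> i \<noteq> j" for i j
      by (auto simp: doubleton_eq_iff)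
    then show ?thesis unfolding proper_colourings_def add_clique_def inj_on_def Un_iff by blast
  qed
  have "proper_colourings (add_clique E B) k = (\<Union>g\<in>?I. ?N g)"
  proof (intro equalityI subsetI)
    fix f assume f: "f \<in> proper_colourings (add_clique E B) k"
    have "restrict f B \<in> ?I" using f unfolding proper by auto
    moreover have "f \<in> ?N (restrict f B)" using f unfolding proper by auto
    ultimately show "f \<in> (\<Union>g\<in>?I. ?N g)" by blast
  next
    fix f assume "f \<in> (\<Union>g\<in>?I. ?N g)"
    then obtain g where "g \<in> ?I" "f \<in> ?N g" by blast
    moreover from this have "inj_on f B" by (auto cong: inj_on_cong)
    ultimately show "f \<in> proper_colourings (add_clique E B) k" unfolding proper by blast
  qed
  moreover have "card (\<Union>g\<in>?I. ?N g) = (\<Sum>g\<in>?I. card (?N g))"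
  proof (rule card_UN_disjoint)
    have "finite (B \<rightarrow>\<^sub>E {..<k})" by (simp add: finite_PiE)
    then show "finite ?I" by simp
    have "finite (UNIV \<rightarrow>\<^sub>E {..<k} :: ('v \<Rightarrow> nat) set)" by (simp add: finite_PiE)
    then show "\<forall>g\<in>?I. finite (?N g)" by (auto elim!: rev_finite_subset)
    show "\<forall>g\<in>?I. \<forall>h\<in>?I. g \<noteq> h \<longrightarrow> ?N g \<inter> ?N h = {}"
    proof (intro ballI impI)
      fix g h assume gh: "g \<in> ?I" "h \<in> ?I" "g \<noteq> h"
      have "g = h" if "f \<in> ?N g" "f \<in> ?N h" for f
      proof (rule PiE_ext)
        show "g \<in> B \<rightarrow>\<^sub>E {..<k}" "h \<in> B \<rightarrow>\<^sub>E {..<k}" using gh by auto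
        show "g b = h b" if "b \<in> B" for b using \<open>f \<in> ?N g\<close> \<open>f \<in> ?N h\<close> that by auto
      qed
      then show "?N g \<inter> ?N h = {}" using gh(3) by blast
    qed
  qed
  moreover have "(\<Sum>g\<in>?I. card (?N g)) = (\<Sum>g\<in>?I. n)"
    by (rule sum.cong[OF refl], rule N) auto
  moreover have "card ?I = prod ((-) k) {0..<card B}"
    using card_inj_on_subset_funcset[of B "{..<k}" B] by simp
  ultimately show ?thesis by simp
qed

text \<open>Uniqueness behind the definite description: polynomials agreeing at all natural numbers
  differ by a polynomial with infinitely many roots.\<close>

lemma chromatic_poly_eqI:
  assumes "\<And>k. poly p (int k) = int (card (proper_colourings E k))"
  shows "chromatic_poly E = p"
  unfolding chromatic_poly_def
proof (rule the_equality)
  fix q assume q: "\<forall>k. poly q (int k) = int (card (proper_colourings E k))"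
  have "range int \<subseteq> {t. poly (q - p) t = 0}" using q assms by auto
  moreover have "infinite (range int)" by (simp add: finite_image_iff)
  ultimately have "q - p = 0" using poly_roots_finite finite_subset by blast
  then show "q = p" by simp
qed (use assms in blast)

lemma chromatic_poly_add_clique:
  fixes E :: "'v::finite set set"
  assumes E: "simple_graph E" and nadj: "\<forall>i\<in>B. \<forall>j\<in>B. {i, j} \<notin> E" and u: "inj_on u B"
  shows "chromatic_poly (add_clique E B) = falling_factorial_poly (card B) *
    characteristic_poly (boundary_space B u) (dirichlet_arrangement E B u)"
    (is "_ = _ * ?\<chi>")
proof (rule chromatic_poly_eqI)
  fix k
  have "card {f. (\<forall>v. f v < k) \<and> (\<forall>b\<in>B. f b = g b) \<and> (\<forall>i j. {i, j} \<in> E \<longrightarrow> f i \<noteq> f j)}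
      = nat (poly ?\<chi> (int k))" and pos: "poly ?\<chi> (int k) \<ge> 0"
    if "\<And>b. b \<in> B \<Longrightarrow> g b < k" "inj_on g B" for g :: "'v \<Rightarrow> nat"
    using poly_characteristic_dirichlet[OF E nadj u, of g k] that by simp_all
  note N = this
  have card: "card (proper_colourings (add_clique E B) k)
      = prod ((-) k) {0..<card B} * nat (poly ?\<chi> (int k))"
    using N(1) by (rule card_proper_colourings_add_clique)
  show "poly (falling_factorial_poly (card B) * ?\<chi>) (int k)
      = int (card (proper_colourings (add_clique E B) k))"
  \<comment> \<open>With enough colours an injective \<open>g\<close> exists, so the value of
    \<open>?\<chi>\<close> is a cardinality and survives conversion by \<open>nat\<close>. With too
    few colours the falling factorial is zero.\<close>
  proof (cases "card B \<le> k")
    case True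
    then obtain g where "inj_on g B" "g ` B \<subseteq> {..<k}"
      using inj_on_iff_card_le[of B "{..<k}"] by auto
    then have "poly ?\<chi> (int k) \<ge> 0" using N(2)[of g] by blast
    then show ?thesis unfolding card by (simp add: poly_falling_factorial)
  next
    case False
    then have "prod ((-) k) {0..<card B} = 0" by (auto intro!: bexI[of _ k])
    then show ?thesis unfolding card poly_mult poly_falling_factorial by simp
  qed
qed

lemma falling_factorial_poly_nonzero: "falling_factorial_poly m \<noteq> 0"
  by (simp add: falling_factorial_poly_def)

subsection \<open>Chambers and current flow\<close>

text \<open>The orientation that current would follow if \<open>x\<close> were the potential. Off
  the hyperplanes it records on which side of each of them \<open>x\<close> lies.\<close>

definition arcs :: "'v::finite set set \<Rightarrow> (real ^ 'v) \<Rightarrow> ('v \<times> 'v) set" where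
  "arcs E x = {(i, j). {i, j} \<in> E \<and> x $ i > x $ j}"

lemma dirichlet_complement:
  "boundary_space B u - \<Union>(dirichlet_arrangement E B u)
    = {x \<in> boundary_space B u. \<forall>i j. {i, j} \<in> E \<longrightarrow> x $ i \<noteq> x $ j}"
  unfolding dirichlet_arrangement_def graphic_arrangement_def by auto

lemma complement_if_arcs_eq:
  assumes "arcs E x = arcs E y" "\<forall>i j. {i, j} \<in> E \<longrightarrow> y $ i \<noteq> y $ j"
  shows "\<forall>i j. {i, j} \<in> E \<longrightarrow> x $ i \<noteq> x $ j"
proof (intro allI impI)
  fix i j assume e: "{i, j} \<in> E"
  then have "(i, j) \<in> arcs E y \<or> (j, i) \<in> arcs E y"
    using assms(2) by (auto simp: arcs_def insert_commute neq_iff)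
  then show "x $ i \<noteq> x $ j" unfolding assms(1)[symmetric] by (auto simp: arcs_def)
qed

text \<open>One direction per edge suffices: every edge is strictly oriented by \<open>y\<close>, so
  preserving these strict inequalities excludes any further arc of \<open>x\<close>.\<close>

lemma arcs_eq_iff:
  assumes "\<forall>i j. {i, j} \<in> E \<longrightarrow> y $ i \<noteq> y $ j"
  shows "arcs E x = arcs E y \<longleftrightarrow> (\<forall>i j. {i, j} \<in> E \<longrightarrow> y $ i > y $ j \<longrightarrow> x $ i > x $ j)"
proof
  assume "arcs E x = arcs E y"
  then show "\<forall>i j. {i, j} \<in> E \<longrightarrow> y $ i > y $ j \<longrightarrow> x $ i > x $ j"
    unfolding arcs_def by auto
next
  assume *: "\<forall>i j. {i, j} \<in> E \<longrightarrow> y $ i > y $ j \<longrightarrow> x $ i > x $ j"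
  have "x $ i > x $ j \<longleftrightarrow> y $ i > y $ j" if e: "{i, j} \<in> E" for i j
  proof -
    have "{j, i} \<in> E" using e by (simp add: insert_commute)
    then show ?thesis using * e assms by (metis linorder_neqE_linordered_idom order_less_asym)
  qed
  then show "arcs E x = arcs E y" unfolding arcs_def by auto
qed

text \<open>The cell is convex, being cut out of an affine subspace by strict linear
  inequalities.\<close>

lemma connected_cell:
  assumes "\<forall>i j. {i, j} \<in> E \<longrightarrow> y $ i \<noteq> y $ j"
  shows "connected {x \<in> boundary_space B u. arcs E x = arcs E y}"
proof (rule convex_connected, rule convexI)
  fix x z :: "real ^ 'a" and s t :: real
  assume xz: "x \<in> {x \<in> boundary_space B u. arcs E x = arcs E y}"
    "z \<in> {x \<in> boundary_space B u. arcs E x = arcs E y}" and st: "0 \<le> s" "0 \<le> t" "s + t = 1"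
  have "s * x $ i + t * z $ i > s * x $ j + t * z $ j" if "x $ i > x $ j" "z $ i > z $ j" for i j
  \<comment> \<open>Strictness has to come from a positive weight: from \<open>s\<close> if it is
    nonzero, and otherwise from \<open>t = 1\<close>.\<close>
  proof (cases "s = 0")
    case False
    then show ?thesis using that st by (intro add_less_le_mono mult_left_mono mult_strict_left_mono) auto
  qed (use that st in auto)
  moreover have "s * a + t * a = a" for a using st(3) by (metis distrib_right mult_1)
  ultimately show "s *\<^sub>R x + t *\<^sub>R z \<in> {x \<in> boundary_space B u. arcs E x = arcs E y}"
    using xz by (auto simp: arcs_eq_iff[OF assms] boundary_space_def)
qed

text \<open>For each edge the complement of the hyperplane is the union of two disjoint open
  half-spaces, and a connected set off the hyperplane lies in one of them.\<close>

lemma arcs_eq_if_connected: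
  assumes C: "connected C" "C \<subseteq> {x. \<forall>i j. {i, j} \<in> E \<longrightarrow> x $ i \<noteq> x $ j}" and xy: "x \<in> C" "y \<in> C"
  shows "arcs E x = arcs E y"
proof -
  have "\<forall>i j. {i, j} \<in> E \<longrightarrow> y $ i \<noteq> y $ j" using C xy by auto
  moreover have "x $ i > x $ j" if e: "{i, j} \<in> E" "y $ i > y $ j" for i j
  proof (rule ccontr)
    assume n: "\<not> x $ i > x $ j"
    let ?A = "{x :: real ^ 'a. x $ j < x $ i}" and ?B = "{x :: real ^ 'a. x $ i < x $ j}"
    have "open ?A" "open ?B" by (intro open_Collect_less continuous_intros)+
    moreover have "C \<subseteq> ?A \<union> ?B" using C(2) e(1) by (auto simp: neq_iff)
    moreover have "?A \<inter> ?B \<inter> C = {}" by auto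
    ultimately have "?A \<inter> C = {} \<or> ?B \<inter> C = {}" using C(1) by (auto dest: connectedD)
    moreover have "x \<in> ?B" using n C(2) xy e(1) by (auto simp: not_less order_less_le)
    ultimately show False using xy e(2) by auto
  qed
  ultimately show ?thesis by (auto simp: arcs_eq_iff)
qed

lemma chambers_dirichlet:
  "chambers (boundary_space B u) (dirichlet_arrangement E B u)
    = (\<lambda>y. {x \<in> boundary_space B u. arcs E x = arcs E y}) `
        {y \<in> boundary_space B u. \<forall>i j. {i, j} \<in> E \<longrightarrow> y $ i \<noteq> y $ j}"
  (is "_ = ?cell ` ?U")
proof -
  have cell: "?cell y \<subseteq> ?U" "y \<in> ?cell y" "connected (?cell y)" if "y \<in> ?U" for y
    using that connected_cell complement_if_arcs_eq by blast+
  have eq: "C = ?cell y" if C: "C \<in> components ?U" "y \<in> C" for C y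
  proof
    have sub: "C \<subseteq> ?U" "connected C" using C in_components_subset in_components_connected by blast+
    then show "C \<subseteq> ?cell y" using arcs_eq_if_connected[of C E _ y] C(2) by blast
    show "?cell y \<subseteq> C"
      by (rule components_maximal[OF C(1)]) (use cell[of y] sub C(2) in blast)+
  qed
  have "components ?U = ?cell ` ?U"
  proof (intro equalityI subsetI)
    fix C assume C: "C \<in> components ?U"
    then obtain y where "y \<in> C" using in_components_nonempty by blast
    moreover from this have "y \<in> ?U" using C in_components_subset by blast
    ultimately show "C \<in> ?cell ` ?U" using eq[OF C] by blast
  next
    fix C assume "C \<in> ?cell ` ?U"
    then obtain y where y: "y \<in> ?U" "C = ?cell y" by blast
    then have "y \<in> \<Union>(components ?U)" using Union_components[of ?U] by simp
    then obtain K where K: "K \<in> components ?U" "y \<in> K" by (rule UnionE)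
    then show "C \<in> components ?U" using eq[OF K] y(2) by simp
  qed
  then show ?thesis unfolding chambers_def dirichlet_complement .
qed

section \<open>Interior extrema and bounded chambers\<close>

text \<open>The link between bounded chambers and current flow. It depends on \<open>x\<close> only
  through \<open>arcs E x\<close>, so it is a property of the whole cell.\<close>

definition no_interior_extremum :: "'v::finite set set \<Rightarrow> 'v set \<Rightarrow> (real ^ 'v) \<Rightarrow> bool" where
  "no_interior_extremum E B x \<longleftrightarrow>
     (\<forall>v. v \<notin> B \<longrightarrow> (\<exists>j. {v, j} \<in> E \<and> x $ j > x $ v) \<and> (\<exists>j. {v, j} \<in> E \<and> x $ j < x $ v))"

lemma no_interior_extremum_arcs:
  assumes "arcs E x = arcs E y" "no_interior_extremum E B y"
  shows "no_interior_extremum E B x"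
proof -
  have eq: "x $ i > x $ j \<longleftrightarrow> y $ i > y $ j" if "{i, j} \<in> E" for i j
    using assms(1) that by (auto simp: arcs_def set_eq_iff)
  have "{v, j} \<in> E \<and> x $ j > x $ v \<longleftrightarrow> {v, j} \<in> E \<and> y $ j > y $ v"
    "{v, j} \<in> E \<and> x $ j < x $ v \<longleftrightarrow> {v, j} \<in> E \<and> y $ j < y $ v" for v j
    using eq[of v j] eq[of j v] by (auto simp: insert_commute)
  then show ?thesis using assms(2) unfolding no_interior_extremum_def by simp
qed

lemma no_interior_extremum_uminus:
  "no_interior_extremum E B (- x) \<longleftrightarrow> no_interior_extremum E B x"
  unfolding no_interior_extremum_def by auto

text \<open>Maximum principle: a vertex of maximal coordinate has no higher neighbour and so belongs
  to \<open>B\<close>. Absolute values are used so that the same bound serves for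
  \<open>- x\<close>.\<close>

lemma le_boundary_max:
  assumes x: "x \<in> boundary_space B u" "no_interior_extremum E B x"
  shows "x $ v \<le> Max ((\<lambda>b. \<bar>u b\<bar>) ` B)"
proof -
  have "range (($) x) \<noteq> {}" "finite (range (($) x))" by auto
  then have "Max (range (($) x)) \<in> range (($) x)" using Max_in by blast
  then obtain w where w: "Max (range (($) x)) = x $ w" by blast
  then have max: "x $ v \<le> x $ w" for v by (metis Max_ge finite finite_imageI rangeI)
  then have "w \<in> B" using x(2) unfolding no_interior_extremum_def by (meson not_less)
  then have "x $ w = u w" using x(1) by (simp add: boundary_space_def)
  moreover have "\<bar>u w\<bar> \<le> Max ((\<lambda>b. \<bar>u b\<bar>) ` B)" using \<open>w \<in> B\<close> by (intro Max_ge) auto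
  ultimately show ?thesis using max[of v] by linarith
qed

lemma bounded_cell_if_no_interior_extremum:
  assumes "no_interior_extremum E B y"
  shows "bounded {x \<in> boundary_space B u. arcs E x = arcs E y}"
proof -
  let ?M = "Max ((\<lambda>b. \<bar>u b\<bar>) ` B)"
  have "\<bar>x $ v\<bar> \<le> ?M" if x: "x \<in> boundary_space B u" "arcs E x = arcs E y" for x v
  proof -
    have ext: "no_interior_extremum E B x" using no_interior_extremum_arcs[OF x(2) assms] .
    then have "x $ v \<le> ?M" using le_boundary_max x by blast
    \<comment> \<open>The lower bound is the maximum principle for \<open>- x\<close>, which has
      boundary values \<open>- u\<close> and hence the same bound.\<close>
    moreover have "(- x) $ v \<le> Max ((\<lambda>b. \<bar>- u b\<bar>) ` B)"
      by (rule le_boundary_max[where E = E])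
        (use x ext in \<open>auto simp: boundary_space_def no_interior_extremum_uminus\<close>)
    ultimately show ?thesis by simp
  qed
  then have "norm x \<le> real CARD('a) * ?M" if "x \<in> {x \<in> boundary_space B u. arcs E x = arcs E y}" for x
    using norm_le_l1_cart[of x] sum_bounded_above[of UNIV "\<lambda>v. \<bar>x $ v\<bar>" ?M] that by force
  then show ?thesis unfolding bounded_iff by blast
qed

text \<open>The sign \<open>s\<close> is 1 at a local maximum and -1 at a local minimum. Pushing the
  coordinate of \<open>v\<close> further in that direction changes no comparison along an edge, so
  the cell contains points arbitrarily far away.\<close>

lemma unbounded_cell_if_local_extremum:
  fixes y :: "real ^ 'v::finite"
  assumes E: "simple_graph E" and y: "y \<in> boundary_space B u" "\<forall>i j. {i, j} \<in> E \<longrightarrow> y $ i \<noteq> y $ j"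
    and v: "v \<notin> B" and s: "\<bar>s\<bar> = 1" and ext: "\<And>j. {v, j} \<in> E \<Longrightarrow> s * (y $ v - y $ j) > 0"
  shows "\<not> bounded {x \<in> boundary_space B u. arcs E x = arcs E y}"
proof
  assume "bounded {x \<in> boundary_space B u. arcs E x = arcs E y}"
  then obtain M where M: "\<And>x. x \<in> boundary_space B u \<Longrightarrow> arcs E x = arcs E y \<Longrightarrow> norm x \<le> M"
    unfolding bounded_iff by blast
  \<comment> \<open>Large enough that the shifted coordinate exceeds \<open>M\<close> in absolute
    value even after the loss of \<open>\<bar>y $ v\<bar>\<close>.\<close>
  define t where "t = \<bar>M\<bar> + \<bar>y $ v\<bar> + 1"
  have t: "t > 0" by (auto simp: t_def)
  define z where "z = y + axis v (s * t)"
  have z: "z $ w = (if w = v then y $ v + s * t else y $ w)" for w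
    by (simp add: z_def axis_def)
  have "z \<in> boundary_space B u" using y(1) v by (auto simp: boundary_space_def z)
  moreover have "arcs E z = arcs E y"
    unfolding arcs_eq_iff[OF y(2)]
  proof (intro allI impI)
    fix i j assume e: "{i, j} \<in> E" and gt: "y $ i > y $ j"
    have ne: "i \<noteq> j" using simple_graph_edge_neq[OF E e] .
    have s': "s = 1 \<or> s = -1" using s by linarith
    consider "i = v" | "j = v" | "i \<noteq> v" "j \<noteq> v" by blast
    then show "z $ i > z $ j"
    proof cases
      case 1
      then have "s = 1" using ext[of j] e gt s' by auto
      then show ?thesis using 1 ne gt t by (simp add: z)
    next
      case 2
      then have "s = -1" using ext[of i] e gt s' by (auto simp: insert_commute)
      then show ?thesis using 2 ne gt t by (simp add: z)
    qed (use gt in \<open>simp add: z\<close>)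
  qed
  ultimately have "norm z \<le> M" using M by blast
  then have "\<bar>z $ v\<bar> \<le> M" using component_le_norm_cart[of z v] by linarith
  moreover have "\<bar>s * t\<bar> = t" using s t by (simp add: abs_mult)
  moreover have "\<bar>s * t\<bar> \<le> \<bar>z $ v\<bar> + \<bar>y $ v\<bar>" by (simp add: z)
  ultimately show False by (simp add: t_def)
qed

lemma bounded_cell_iff:
  fixes y :: "real ^ 'v::finite"
  assumes E: "simple_graph E" and y: "y \<in> boundary_space B u" "\<forall>i j. {i, j} \<in> E \<longrightarrow> y $ i \<noteq> y $ j"
  shows "bounded {x \<in> boundary_space B u. arcs E x = arcs E y} \<longleftrightarrow> no_interior_extremum E B y"
proof
  assume bd: "bounded {x \<in> boundary_space B u. arcs E x = arcs E y}"
  show "no_interior_extremum E B y"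
    unfolding no_interior_extremum_def
  proof (intro allI impI conjI)
    fix v assume v: "v \<notin> B"
    show "\<exists>j. {v, j} \<in> E \<and> y $ j > y $ v"
      using unbounded_cell_if_local_extremum[OF E y v, of 1] bd y(2)
      by (metis abs_one diff_gt_0_iff_gt mult_1 linorder_neqE_linordered_idom)
    show "\<exists>j. {v, j} \<in> E \<and> y $ j < y $ v"
      using unbounded_cell_if_local_extremum[OF E y v, of "-1"] bd y(2)
      by (metis abs_minus_cancel abs_one diff_gt_0_iff_gt minus_diff_eq mult_minus1 linorder_neqE_linordered_idom)
  qed
qed (rule bounded_cell_if_no_interior_extremum)

section \<open>Potentials, flows and conductances\<close>

lemma no_isolated_vertex:
  assumes "connected_graph E" "w \<noteq> v"
  shows "\<exists>j. {v, j} \<in> E"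
proof -
  have "(v, w) \<in> {(a, b). {a, b} \<in> E}\<^sup>*"
    using assms(1) by (simp add: connected_graph_def induces_connected_def)
  then show ?thesis using assms(2) by (cases rule: converse_rtranclE) auto
qed

lemma sum_zero_has_pos:
  fixes f :: "'a \<Rightarrow> real"
  assumes "finite N" "N \<noteq> {}" "sum f N = 0" "\<And>j. j \<in> N \<Longrightarrow> f j \<noteq> 0"
  shows "\<exists>j\<in>N. f j > 0"
proof (rule ccontr)
  assume "\<not> ?thesis"
  then have "f j < 0" if "j \<in> N" for j using assms(4) that by force
  then have "sum f N < (\<Sum>j\<in>N. 0)" using assms(1,2) by (rule sum_strict_mono[rotated 2])
  then show False using assms(3) by simp
qed

text \<open>Net current leaving \<open>w\<close>. The point \<open>x\<close> is held fixed and the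
  conductances vary; in them the expression is linear, which permits superposition.\<close>

definition current_divergence ::
    "'v::finite set set \<Rightarrow> (real ^ 'v) \<Rightarrow> ('v set \<Rightarrow> real) \<Rightarrow> 'v \<Rightarrow> real" where
  "current_divergence E x c w = (\<Sum>j\<in>{j. {w, j} \<in> E}. c {w, j} * (x $ w - x $ j))"

text \<open>The currents at an interior vertex are nonzero and sum to zero, so both signs occur.
  Conductances being positive, the signs reveal a lower and a higher neighbour; connectedness
  provides at least one neighbour.\<close>

lemma no_interior_extremum_potential:
  fixes h :: "real ^ 'v::finite"
  assumes E: "connected_graph E" and B: "b \<in> B" and c: "\<forall>e\<in>E. c e > 0"
    and h: "is_potential E B u c h" "\<forall>i j. {i, j} \<in> E \<longrightarrow> h $ i \<noteq> h $ j"
  shows "no_interior_extremum E B h"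
  unfolding no_interior_extremum_def
proof (intro allI impI)
  fix v assume v: "v \<notin> B"
  let ?N = "{j. {v, j} \<in> E}"
  let ?f = "\<lambda>j. c {v, j} * (h $ v - h $ j)"
  have N: "finite ?N" "?N \<noteq> {}" using no_isolated_vertex[OF E, of b v] B v by auto
  have "sum ?f ?N = 0" using h(1) v by (simp add: is_potential_def)
  moreover have nz: "?f j \<noteq> 0" if "j \<in> ?N" for j using that c h(2) by fastforce
  ultimately have "\<exists>j\<in>?N. ?f j > 0" using sum_zero_has_pos[OF N] by blast
  moreover have "\<exists>j\<in>?N. - ?f j > 0"
    using sum_zero_has_pos[OF N, of "\<lambda>j. - ?f j"] nz \<open>sum ?f ?N = 0\<close> by (simp add: sum_negf)
  ultimately show "(\<exists>j. {v, j} \<in> E \<and> h $ j > h $ v) \<and> (\<exists>j. {v, j} \<in> E \<and> h $ j < h $ v)"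
    using c by (auto simp: zero_less_mult_iff mult_less_0_iff dest: bspec)
qed

lemma current_divergence_add:
  "current_divergence E x (\<lambda>e. c e + d e) w = current_divergence E x c w + current_divergence E x d w"
  by (simp add: current_divergence_def distrib_right sum.distrib)

lemma current_divergence_sum:
  "current_divergence E x (\<lambda>e. \<Sum>a\<in>A. c a e) w = (\<Sum>a\<in>A. current_divergence E x (c a) w)"
  unfolding current_divergence_def sum_distrib_right by (rule sum.swap)

text \<open>The conductance is normalised so that the edge carries one unit of current from
  \<open>p\<close> to \<open>v\<close>.\<close>

lemma current_divergence_single_edge:
  assumes e: "{p, v} \<in> E" "x $ p \<noteq> x $ v"
  shows "current_divergence E x (\<lambda>e. if e = {p, v} then 1 / (x $ p - x $ v) else 0) w
    = of_bool (w = p) - of_bool (w = v)"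
proof -
  have ne: "p \<noteq> v" using e by auto
  have "current_divergence E x (\<lambda>e. if e = {p, v} then 1 / (x $ p - x $ v) else 0) w
    = (\<Sum>j\<in>{j. {w, j} \<in> E}. if {w, j} = {p, v} then (x $ w - x $ j) / (x $ p - x $ v) else 0)"
    unfolding current_divergence_def by (rule sum.cong) auto
  also have "\<dots> = (\<Sum>j\<in>{j. {w, j} \<in> E}. (if j = v then of_bool (w = p) else 0)
      - (if j = p then of_bool (w = v) else 0))"
    by (rule sum.cong[OF refl])
      (use e ne in \<open>auto simp: doubleton_eq_iff divide_simps\<close>)
  also have "\<dots> = of_bool (w = p) - of_bool (w = v)"
    using e(1) ne by (auto simp: sum_subtractf insert_commute)
  finally show ?thesis .
qed

text \<open>A unit flow from the boundary into \<open>v\<close> along a path of decreasing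
  coordinates. The induction climbs from \<open>v\<close> to a higher neighbour \<open>p\<close>,
  extending a flow into \<open>p\<close> by one unit along the edge to \<open>v\<close>.\<close>

lemma flow_from_above:
  fixes x :: "real ^ 'v::finite"
  assumes x: "\<And>v. v \<notin> B \<Longrightarrow> \<exists>p. {v, p} \<in> E \<and> x $ p > x $ v"
  shows "\<exists>c. (\<forall>e. c e \<ge> 0) \<and> (\<forall>w. w \<notin> B \<longrightarrow> current_divergence E x c w = - of_bool (w = v))"
proof (induction "card {w. x $ w > x $ v}" arbitrary: v rule: less_induct)
  case less
  show ?case
  proof (cases "v \<in> B")
    case True
    \<comment> \<open>The zero flow suffices, since the divergence is prescribed at interior
      vertices only.\<close>
    then show ?thesis by (intro exI[of _ "\<lambda>_. 0"]) (auto simp: current_divergence_def)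
  next
    case False
    then obtain p where p: "{p, v} \<in> E" "x $ p > x $ v" using x by (metis insert_commute)
    then have "{w. x $ w > x $ p} \<subset> {w. x $ w > x $ v}" by auto
    then have "card {w. x $ w > x $ p} < card {w. x $ w > x $ v}" by (simp add: psubset_card_mono)
    from less[OF this] obtain c where c: "\<And>e. c e \<ge> 0"
      "\<And>w. w \<notin> B \<Longrightarrow> current_divergence E x c w = - of_bool (w = p)" by blast
    let ?d = "\<lambda>e. if e = {p, v} then 1 / (x $ p - x $ v) else 0"
    have "current_divergence E x (\<lambda>e. c e + ?d e) w = - of_bool (w = v)" if "w \<notin> B" for w
      using c(2)[OF that] current_divergence_single_edge[OF p(1), of x w] p(2)
      unfolding current_divergence_add by simp
    moreover have "c e + ?d e \<ge> 0" for e using c(1)[of e] p(2) by simp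
    ultimately show ?thesis by (intro exI[of _ "\<lambda>e. c e + ?d e"]) blast
  qed
qed

text \<open>Negating \<open>x\<close> exchanges higher and lower neighbours and reverses every
  current.\<close>

lemma flow_to_below:
  fixes x :: "real ^ 'v::finite"
  assumes x: "\<And>v. v \<notin> B \<Longrightarrow> \<exists>p. {v, p} \<in> E \<and> x $ p < x $ v"
  shows "\<exists>c. (\<forall>e. c e \<ge> 0) \<and> (\<forall>w. w \<notin> B \<longrightarrow> current_divergence E x c w = of_bool (w = v))"
proof -
  have neg: "current_divergence E (- x) c w = - current_divergence E x c w" for c w
    by (simp add: current_divergence_def sum_negf[symmetric] algebra_simps)
  obtain c where "\<forall>e. c e \<ge> 0"
    "\<forall>w. w \<notin> B \<longrightarrow> current_divergence E (- x) c w = - of_bool (w = v)"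
    using flow_from_above[of B E "- x" v] x by auto
  then show ?thesis unfolding neg by (intro exI[of _ c]) (metis neg_equal_iff_equal)
qed

text \<open>Through each edge \<open>a\<close> from \<open>p\<close> down to \<open>v\<close> runs a
  boundary-to-boundary flow: a unit into \<open>p\<close> from above, a unit across
  \<open>a\<close>, a unit out of \<open>v\<close> to below. Its divergence vanishes at interior
  vertices and its conductance on \<open>a\<close> is positive.\<close>

lemma conductances_exist:
  fixes x :: "real ^ 'v::finite"
  assumes E: "simple_graph E" and x: "x \<in> boundary_space B u"
    "\<forall>i j. {i, j} \<in> E \<longrightarrow> x $ i \<noteq> x $ j" "no_interior_extremum E B x"
  shows "\<exists>c. (\<forall>e\<in>E. c e > 0) \<and> is_potential E B u c x"
proof -
  have "\<exists>c. (\<forall>e. c e \<ge> 0) \<and> (\<forall>w. w \<notin> B \<longrightarrow> current_divergence E x c w = 0) \<and> c a > 0"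
    if a: "a \<in> E" for a
  proof -
    obtain i j where "a = {i, j}" "x $ i \<noteq> x $ j"
      using a E x(2) by (auto simp: simple_graph_def card_2_iff dest!: bspec)
    then obtain p v where pv: "a = {p, v}" "x $ p > x $ v"
      by (metis insert_commute linorder_neqE_linordered_idom)
    obtain c where c: "\<And>e. c e \<ge> 0"
      "\<And>w. w \<notin> B \<Longrightarrow> current_divergence E x c w = - of_bool (w = p)"
      using flow_from_above[of B E x p] x(3) unfolding no_interior_extremum_def by blast
    obtain d where d: "\<And>e. d e \<ge> 0"
      "\<And>w. w \<notin> B \<Longrightarrow> current_divergence E x d w = of_bool (w = v)"
      using flow_to_below[of B E x v] x(3) unfolding no_interior_extremum_def by blast
    let ?f = "\<lambda>e. if e = {p, v} then 1 / (x $ p - x $ v) else 0"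
    let ?c = "\<lambda>e. (c e + ?f e) + d e"
    have "current_divergence E x ?c w = 0" if "w \<notin> B" for w
      using c(2)[OF that] d(2)[OF that] current_divergence_single_edge[of p v E x w] pv a
      unfolding current_divergence_add by simp
    moreover have "?c e \<ge> 0" for e using c(1)[of e] d(1)[of e] pv(2) by simp
    moreover have "?c a > 0" using c(1)[of a] d(1)[of a] pv by (simp add: add_nonneg_pos add_pos_nonneg)
    ultimately show ?thesis by (intro exI[of _ ?c]) blast
  qed
  then obtain c where c: "\<And>a e. a \<in> E \<Longrightarrow> c a e \<ge> 0"
    "\<And>a w. a \<in> E \<Longrightarrow> w \<notin> B \<Longrightarrow> current_divergence E x (c a) w = 0" "\<And>a. a \<in> E \<Longrightarrow> c a a > 0"
    by metis
  \<comment> \<open>Summing the flows over all edges makes every conductance positive and keeps the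
    interior divergence zero.\<close>
  let ?c = "\<lambda>e. \<Sum>a\<in>E. c a e"
  have "?c e > 0" if "e \<in> E" for e
    using that c by (intro sum_pos2[of E e]) auto
  moreover have "current_divergence E x ?c w = 0" if "w \<notin> B" for w
    using c(2) that by (simp add: current_divergence_sum)
  ultimately show ?thesis using x(1)
    by (intro exI[of _ ?c])
      (simp add: is_potential_def boundary_space_def current_divergence_def)
qed

section \<open>Current orientations and bounded chambers\<close>

lemma arcs_orientation:
  assumes "\<forall>i j. {i, j} \<in> E \<longrightarrow> x $ i \<noteq> x $ j"
  shows "arcs E x \<in> orientations E"
  using assms unfolding orientations_def arcs_def
  by (auto simp: insert_commute not_less order_less_le)

text \<open>A potential has no interior extremum; conversely, a point without one is itself the
  potential for suitable conductances.\<close>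

lemma current_orientations_eq:
  fixes E :: "'v::finite set set"
  assumes E: "simple_graph E" "connected_graph E" and B: "b \<in> B"
  shows "current_orientations E B u = arcs E ` {x \<in> boundary_space B u.
    (\<forall>i j. {i, j} \<in> E \<longrightarrow> x $ i \<noteq> x $ j) \<and> no_interior_extremum E B x}"
proof (intro equalityI subsetI)
  fix D assume "D \<in> current_orientations E B u"
  then obtain c h where D: "D \<in> orientations E" and c: "\<forall>e\<in>E. c e > 0"
    and h: "is_potential E B u c h" "\<forall>i j. {i, j} \<in> E \<longrightarrow> h $ i \<noteq> h $ j"
    and Dh: "\<forall>i j. {i, j} \<in> E \<longrightarrow> ((i, j) \<in> D \<longleftrightarrow> h $ i > h $ j)"
    unfolding current_orientations_def by blast
  have "(i, j) \<in> D \<Longrightarrow> {i, j} \<in> E" for i j using D unfolding orientations_def by blast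
  then have "(i, j) \<in> D \<longleftrightarrow> (i, j) \<in> arcs E h" for i j
    using Dh unfolding arcs_def by blast
  then have "D = arcs E h" by auto
  moreover have "h \<in> boundary_space B u" using h(1) by (simp add: is_potential_def boundary_space_def)
  ultimately show "D \<in> arcs E ` {x \<in> boundary_space B u.
    (\<forall>i j. {i, j} \<in> E \<longrightarrow> x $ i \<noteq> x $ j) \<and> no_interior_extremum E B x}"
    using no_interior_extremum_potential[OF E(2) B c h] h(2) by blast
next
  fix D assume "D \<in> arcs E ` {x \<in> boundary_space B u.
    (\<forall>i j. {i, j} \<in> E \<longrightarrow> x $ i \<noteq> x $ j) \<and> no_interior_extremum E B x}"
  then obtain x where D: "D = arcs E x" and x: "x \<in> boundary_space B u"
    "\<forall>i j. {i, j} \<in> E \<longrightarrow> x $ i \<noteq> x $ j" "no_interior_extremum E B x" by blast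
  obtain c where "\<forall>e\<in>E. c e > 0" "is_potential E B u c x"
    using conductances_exist[OF E(1) x] by blast
  moreover have "\<forall>i j. {i, j} \<in> E \<longrightarrow> ((i, j) \<in> D \<longleftrightarrow> x $ i > x $ j)" by (simp add: D arcs_def)
  ultimately show "D \<in> current_orientations E B u"
    unfolding current_orientations_def using D x(2) arcs_orientation[OF x(2)] by blast
qed

text \<open>A current orientation is recovered from any point of its cell, which gives injectivity.
  The image is the set of bounded chambers because both sides are described by
  \<open>no_interior_extremum\<close>.\<close>

lemma bij_betw_cells_current_orientations:
  fixes E :: "'v::finite set set"
  assumes E: "simple_graph E" "connected_graph E" and B: "b \<in> B"
  shows "bij_betw (\<lambda>D. {x \<in> boundary_space B u. arcs E x = D}) (current_orientations E B u)
    {C \<in> chambers (boundary_space B u) (dirichlet_arrangement E B u). bounded C}"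
    (is "bij_betw ?g _ _")
proof -
  have "inj_on ?g (current_orientations E B u)"
    unfolding current_orientations_eq[OF assms] by (rule inj_onI) blast
  moreover have "?g ` current_orientations E B u
      = {C \<in> chambers (boundary_space B u) (dirichlet_arrangement E B u). bounded C}"
    unfolding current_orientations_eq[OF assms] chambers_dirichlet
    using bounded_cell_iff[OF E(1)] by blast
  ultimately show ?thesis by (simp add: bij_betw_def)
qed

theorem theorem1p1:
  fixes E :: "'v::finite set set" and B :: "'v set" and u :: "'v \<Rightarrow> real" and m :: nat
  assumes "simple_graph E" and "connected_graph E"
    and "B \<subset> UNIV" and "card B = m" and "m \<ge> 2"
    and "\<forall>i\<in>B. \<forall>j\<in>B. {i, j} \<notin> E"
    and "inj_on u B"
  shows
    "(poset_iso_map partition_flat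
        (connected_partitions E) (refines UNIV)
        (intersection_poset UNIV (graphic_arrangement E)) (\<supseteq>) \<and>
      order_ideal
        (partition_flat ` {\<pi> \<in> connected_partitions E. boundary_separating B \<pi>})
        (intersection_poset UNIV (graphic_arrangement E)) (\<supseteq>) \<and>
      posets_isomorphic
        (intersection_poset (boundary_space B u) (dirichlet_arrangement E B u)) (\<supseteq>)
        (partition_flat ` {\<pi> \<in> connected_partitions E. boundary_separating B \<pi>}) (\<supseteq>))
     \<and>
     (falling_factorial_poly m dvd chromatic_poly (add_clique E B) \<and>
      characteristic_poly (boundary_space B u) (dirichlet_arrangement E B u) =
        chromatic_poly (add_clique E B) div falling_factorial_poly m)
     \<and>
     (\<exists>f. bij_betw f
        {C \<in> chambers (boundary_space B u) (dirichlet_arrangement E B u). bounded C}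
        (current_orientations E B u))"
proof (intro conjI)
  show "poset_iso_map partition_flat (connected_partitions E) (refines UNIV)
      (intersection_poset UNIV (graphic_arrangement E)) (\<supseteq>)"
    by (rule poset_iso_map_partition_flat)
  show "order_ideal (partition_flat ` {\<pi> \<in> connected_partitions E. boundary_separating B \<pi>})
      (intersection_poset UNIV (graphic_arrangement E)) (\<supseteq>)"
    by (rule order_ideal_boundary_separating)
  show "posets_isomorphic
      (intersection_poset (boundary_space B u) (dirichlet_arrangement E B u)) (\<supseteq>)
      (partition_flat ` {\<pi> \<in> connected_partitions E. boundary_separating B \<pi>}) (\<supseteq>)"
    using assms(7) by (rule dirichlet_poset_isomorphic)
  have chromatic: "chromatic_poly (add_clique E B) = falling_factorial_poly m *
      characteristic_poly (boundary_space B u) (dirichlet_arrangement E B u)"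
    using chromatic_poly_add_clique[OF assms(1,6,7)] assms(4) by simp
  then show "falling_factorial_poly m dvd chromatic_poly (add_clique E B)" by simp
  show "characteristic_poly (boundary_space B u) (dirichlet_arrangement E B u) =
      chromatic_poly (add_clique E B) div falling_factorial_poly m"
    unfolding chromatic using falling_factorial_poly_nonzero by simp
  have "B \<noteq> {}" using assms(4,5) by auto
  then obtain b where "b \<in> B" by blast
  then show "\<exists>f. bij_betw f
      {C \<in> chambers (boundary_space B u) (dirichlet_arrangement E B u). bounded C}
      (current_orientations E B u)"
    using bij_betw_cells_current_orientations[OF assms(1,2)] bij_betw_inv by blast
qed

end
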